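(* Let $N=\frac{n^2-n}{2}$, let $D_1=\begin{pmatrix}0&1\\-1&0\end{pmatrix}$ and $D_j=\begin{pmatrix}0&2\\-2&0\end{pmatrix}$ for $j=2,3,\dots,N$. Then a canonical form of the defining matrix $\mathcal M_q^0(n)$ of $J_q^0(n)$ is $\mathrm{diag}(D_1,D_2,\dots,D_N,0,\dots,0)$.
   Context: $J^0_q(n)$ is the algebra with generators $J_{i,j}$, $1\le i,j\le n$, and relations $J_{i,j}J_{s,t}=q^{s+t-i-j}J_{s,t}J_{i,j}$ if $(s-i)(t-j)\le0$, and $q^{1-t+j}J_{i,j}J_{s,t}=q^{s-i-1}J_{s,t}J_{i,j}+(q-q^{-1})J_{i,t}J_{s,j}$ if $s>i$ and $t>j$. Dropping the last terms $(q-q^{-1})J_{i,t}J_{s,j}$ and writing the relations as $x_{i,j}x_{s,t}=q^{h_{[i,j],[s,t]}}x_{s,t}x_{i,j}$ gives the defining matrix: it is the skew-symmetric integer $n^2\times n^2$ matrix $\mathcal M_q^0(n)=(h_{[i,j],[s,t]})$, indexed by pairs in lexicographic order, with $h_{[i,j],[s,t]}=s+t-i-j$ if $(s-i)(t-j)\le 0$, $h_{[i,j],[s,t]}=s+t-i-j-2$ if $s>i$ and $t>j$, and $h_{[i,j],[s,t]}=s+t-i-j+2$ if $s<i$ and $t<j$. A canonical form of a skew-symmetric integer $n^2\times n^2$ matrix $\mathcal M$ is a block diagonal matrix, with $2\times2$ blocks $\begin{pmatrix}0&-m_i\\ m_i&0\end{pmatrix}$ ($m_i\in\mathbb Z$)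 and possibly a $1\times 1$ zero block, of the form $W\mathcal M W^t$ with $W\in SL(n^2,\mathbb Z)$. *)

theory Defs
  imports "Jordan_Normal_Form.Determinant"
begin

text \<open>The exponents of the quasipolynomial relations
  \<open>x\<^bsub>i,j\<^esub> x\<^bsub>s,t\<^esub> = q\<^bsup>h\<^esup> x\<^bsub>s,t\<^esub> x\<^bsub>i,j\<^esub>\<close>
  obtained from the relations of \<open>J\<^sup>0\<^sub>q(n)\<close> by dropping the terms
  \<open>(q - q\<^sup>-\<^sup>1) J\<^bsub>i,t\<^esub> J\<^bsub>s,j\<^esub>\<close>.
  The three cases are exclusive and exhaustive.\<close>

definition h_exp :: "int \<times> int \<Rightarrow> int \<times> int \<Rightarrow> int" where
  "h_exp = (\<lambda>(i, j) (s, t).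
     if (s - i) * (t - j) \<le> 0 then s + t - i - j
     else if s > i \<and> t > j then s + t - i - j - 2
     else s + t - i - j + 2)"

text \<open>Rows and columns of a \<open>mat\<close> are numbered from \<open>0\<close>; position \<open>k < n\<^sup>2\<close> carries the
  \<open>k\<close>-th pair of \<open>{1..n} \<times> {1..n}\<close> in lexicographic order.\<close>

definition lex_pair :: "nat \<Rightarrow> nat \<Rightarrow> int \<times> int" where
  "lex_pair n k = (int (k div n) + 1, int (k mod n) + 1)"

definition defining_matrix :: "nat \<Rightarrow> int mat" where
  "defining_matrix n = mat (n ^ 2) (n ^ 2) (\<lambda>(k, l). h_exp (lex_pair n k) (lex_pair n l))"

definition skew_block :: "int \<Rightarrow> int mat" where
  "skew_block m = mat_of_rows_list 2 [[0, - m], [m, 0]]"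

definition canonical_shape :: "int mat \<Rightarrow> bool" where
  "canonical_shape C \<longleftrightarrow> (\<exists>ms. C = diag_block_mat (map skew_block ms) \<or>
     C = diag_block_mat (map skew_block ms @ [0\<^sub>m 1 1]))"

definition is_canonical_form :: "nat \<Rightarrow> int mat \<Rightarrow> int mat \<Rightarrow> bool" where
  "is_canonical_form d M C \<longleftrightarrow>
     M \<in> carrier_mat d d \<and> transpose_mat M = - M \<and> canonical_shape C \<and>
     (\<exists>W \<in> carrier_mat d d. det W = 1 \<and> C = W * M * transpose_mat W)"

definition D_block :: "nat \<Rightarrow> int mat" where
  "D_block j = (if j = 1 then mat_of_rows_list 2 [[0, 1], [-1, 0]]
                else mat_of_rows_list 2 [[0, 2], [-2, 0]])"

end

theory Submission
  imports Defs "HOL-Combinatorics.Transposition"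
begin

text \<open>The defining matrix \<open>M\<close> is alternating, so by the elementary divisor theorem for alternating
  integer matrices (\<open>skew_normal_form\<close>) it is congruent under determinant one to a block diagonal
  matrix with entries \<open>m\<^sub>0, m\<^sub>1, \<dots>\<close>, each dividing the next. It remains to find these numbers, and for
  that it is not necessary to know the transformation.

  The main point is an integral half inverse \<open>K\<close>, with \<open>M K M = 2 M\<close>
  (\<open>defining_matrix_half_inverse\<close>). Such a \<open>K\<close> passes to the normal form, where it forces each nonzero
  \<open>m\<^sub>i\<close> to divide \<open>2\<close>. Moreover \<open>M K / 2\<close> is a projection onto the rational column space of \<open>M\<close>, so the
  trace of \<open>M K\<close> is twice the rank; it equals \<open>2 (n\<^sup>2 - n)\<close>, and there are \<open>N\<close> nonzero blocks.

  To find \<open>K\<close>, vectors of length \<open>n\<^sup>2\<close> are seen as \<open>n \<times> n\<close> grids \<open>X\<close>, and a grid is described by the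
  table \<open>R\<close> of its cumulative sums. The terms \<open>\<plusminus> 2\<close> of the exponents sum \<open>X\<close> over the positions that
  dominate, or are dominated by, a given one. Both are values of \<open>R\<close>, and \<open>M\<close> becomes the difference
  of \<open>R\<close> along diagonals, up to boundary terms (\<open>form_op_mixed_diff\<close>). So \<open>M X = 2 G\<close> is solved by
  summing along diagonals (\<open>potential\<close>), and it is solvable exactly under \<open>n\<close> linear conditions on the
  full diagonal sums of \<open>G\<close> (\<open>defect\<close>).

  Finally, modulo \<open>2\<close> the exponents are \<open>(s + t) - (i + j)\<close>, a form of rank at most two, so \<open>m\<^sub>0 m\<^sub>1\<close>
  is even (\<open>pfaffian_even\<close>). On the other hand \<open>M\<close> has an entry \<open>1\<close> if \<open>n \<ge> 2\<close>, so \<open>m\<^sub>0\<close> is odd. Hence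
  \<open>m\<^sub>0 = \<plusminus> 1\<close> and the other nonzero entries are \<open>\<plusminus> 2\<close>; the signs can be made positive because the normal
  form has a zero row.\<close>

section \<open>Normal form of alternating integer matrices\<close>

definition sl_congruent :: "nat \<Rightarrow> int mat \<Rightarrow> int mat \<Rightarrow> bool" where
  "sl_congruent d A B \<longleftrightarrow>
     (\<exists>W \<in> carrier_mat d d. det W = 1 \<and> B = W * A * transpose_mat W)"

definition alternating :: "nat \<Rightarrow> int mat \<Rightarrow> bool" where
  "alternating d A \<longleftrightarrow> A \<in> carrier_mat d d \<and> (\<forall>i<d. \<forall>j<d. A $$ (i, j) = - A $$ (j, i))"

lemma alternating_diag: "alternating d A \<Longrightarrow> i < d \<Longrightarrow> A $$ (i, i) = 0"
proof -
  assume "alternating d A" "i < d"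
  then have "A $$ (i, i) = - A $$ (i, i)" unfolding alternating_def by blast
  then show ?thesis by simp
qed

lemma alternating_swap:
  "alternating d A \<Longrightarrow> i < d \<Longrightarrow> j < d \<Longrightarrow> A $$ (i, j) = - A $$ (j, i)"
  unfolding alternating_def by blast

lemma sl_congruent_refl: "A \<in> carrier_mat d d \<Longrightarrow> sl_congruent d A A"
  unfolding sl_congruent_def by (rule bexI[of _ "1\<^sub>m d"]) auto

lemma sl_congruent_trans:
  assumes A: "A \<in> carrier_mat d d" and "sl_congruent d A B" "sl_congruent d B C"
  shows "sl_congruent d A C"
proof -
  obtain V where V: "V \<in> carrier_mat d d" "det V = 1" "B = V * A * transpose_mat V"
    using assms(2) unfolding sl_congruent_def by blast
  obtain W where W: "W \<in> carrier_mat d d" "det W = 1" "C = W * B * transpose_mat W"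
    using assms(3) unfolding sl_congruent_def by blast
  have "(W * V) * A * transpose_mat (W * V) = (W * V) * A * (transpose_mat V * transpose_mat W)"
    by (subst transpose_mult[OF W(1) V(1)]) simp
  also have "\<dots> = C"
    using A V(1) W(1) unfolding W(3) V(3)
    by (simp add: assoc_mult_mat[of _ d d _ d _ d])
  finally have "C = (W * V) * A * transpose_mat (W * V)" by simp
  moreover have "det (W * V) = 1" using det_mult[OF W(1) V(1)] V(2) W(2) by simp
  ultimately show ?thesis
    unfolding sl_congruent_def using V(1) W(1) by (intro bexI[of _ "W * V"]) auto
qed

text \<open>The congruence that adds \<open>c\<close> times row and column \<open>a\<close> to row and column \<open>b\<close>.
  The term \<open>c\<^sup>2 A\<^bsub>a,a\<^esub>\<close> at position \<open>(b, b)\<close> is left out because it vanishes for the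
  alternating matrices to which the operation is applied.\<close>
definition transvect :: "nat \<Rightarrow> nat \<Rightarrow> nat \<Rightarrow> int \<Rightarrow> int mat \<Rightarrow> int mat" where
  "transvect d a b c A = mat d d (\<lambda>(i, j). A $$ (i, j)
     + (if i = b then c * A $$ (a, j) else 0) + (if j = b then c * A $$ (i, a) else 0))"

lemma transvect_entry:
  "i < d \<Longrightarrow> j < d \<Longrightarrow> transvect d a b c A $$ (i, j) = A $$ (i, j)
     + (if i = b then c * A $$ (a, j) else 0) + (if j = b then c * A $$ (i, a) else 0)"
  unfolding transvect_def by simp

lemma alternating_transvect:
  assumes "alternating d A" "a < d" "b < d"
  shows "alternating d (transvect d a b c A)"
  unfolding alternating_def
proof (intro conjI allI impI)
  show "transvect d a b c A \<in> carrier_mat d d" unfolding transvect_def by simp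
  fix i j assume ij: "i < d" "j < d"
  show "transvect d a b c A $$ (i, j) = - transvect d a b c A $$ (j, i)"
    using alternating_swap[OF assms(1), of i j] alternating_swap[OF assms(1), of i a]
      alternating_swap[OF assms(1), of a j] ij assms
    by (auto simp: transvect_entry)
qed

lemma sl_congruent_transvect:
  assumes A: "alternating d A" and ab: "a < d" "b < d" "a \<noteq> b"
  shows "sl_congruent d A (transvect d a b c A)"
proof -
  let ?W = "addrow_mat d c b a"
  have cA: "A \<in> carrier_mat d d" using A unfolding alternating_def by blast
  have 1: "?W * A = addrow c b a A" using addrow_mat[OF cA ab(1)] by simp
  have c1: "addrow c b a A \<in> carrier_mat d d" using cA by (auto simp: mat_addrow_def)
  have "addrow c b a A * transpose_mat ?W = transpose_mat (?W * transpose_mat (addrow c b a A))"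
    using c1 by (subst transpose_mult[of _ d d _ d]) auto
  also have "?W * transpose_mat (addrow c b a A) = addrow c b a (transpose_mat (addrow c b a A))"
    using c1 by (subst addrow_mat[of _ d d a, symmetric]) (auto simp: ab)
  also have "transpose_mat \<dots> = transvect d a b c A"
    using cA ab alternating_diag[OF A ab(1)]
    by (intro eq_matI) (auto simp: transvect_def mat_addrow_def algebra_simps)
  finally have "transvect d a b c A = ?W * A * transpose_mat ?W" using 1 by simp
  then show ?thesis unfolding sl_congruent_def
    using det_addrow_mat[of b a d c] ab by (intro bexI[of _ ?W]) auto
qed

text \<open>The entries of a block diagonal matrix with \<open>2 \<times> 2\<close> blocks
  \<open>(0, m\<^sub>h; - m\<^sub>h, 0)\<close>, as a function on all positions, so that it describes the top left
  corner of any size, including one that cuts through a block.\<close>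
definition skew_entry :: "(nat \<Rightarrow> int) \<Rightarrow> nat \<Rightarrow> nat \<Rightarrow> int" where
  "skew_entry ms i j = (if even i \<and> j = Suc i then ms (i div 2)
     else if even j \<and> i = Suc j then - ms (j div 2) else 0)"

lemma skew_entry_antisym: "skew_entry f j i = - skew_entry f i j"
  unfolding skew_entry_def by auto

text \<open>The invariant of the elimination: \<open>B\<close> is congruent to \<open>A\<close>, its first \<open>k\<close> blocks are split
  off, and \<open>g\<close> divides what remains. The elimination takes for \<open>g\<close> the entry of the last block
  split off; keeping it in the invariant is what makes consecutive block entries divide each other.\<close>
definition stage :: "nat \<Rightarrow> int mat \<Rightarrow> (nat \<Rightarrow> int) \<Rightarrow> nat \<Rightarrow> int \<Rightarrow> int mat \<Rightarrow> bool" where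
  "stage d A ms k g B \<longleftrightarrow> sl_congruent d A B \<and> alternating d B
     \<and> (\<forall>i<d. \<forall>j<d. i < 2 * k \<or> j < 2 * k \<longrightarrow> B $$ (i, j) = skew_entry ms i j)
     \<and> (\<forall>i\<in>{2*k..<d}. \<forall>j\<in>{2*k..<d}. g dvd B $$ (i, j))"

lemma skew_entry_off:
  assumes "i < 2 * k" "2 * k \<le> a"
  shows "skew_entry ms i a = 0" "skew_entry ms a i = 0"
proof -
  have "\<not> (even i \<and> a = Suc i)" "\<not> (even a \<and> i = Suc a)"
    using assms by presburger+
  then show "skew_entry ms i a = 0" "skew_entry ms a i = 0" unfolding skew_entry_def by auto
qed

lemma stageD:
  assumes "stage d A ms k g B"
  shows stage_congruent: "sl_congruent d A B"
    and stage_alternating: "alternating d B"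
    and stage_normal: "\<And>i j. i < d \<Longrightarrow> j < d \<Longrightarrow> i < 2 * k \<or> j < 2 * k \<Longrightarrow> B $$ (i, j) = skew_entry ms i j"
    and stage_dvd: "\<And>i j. i \<in> {2*k..<d} \<Longrightarrow> j \<in> {2*k..<d} \<Longrightarrow> g dvd B $$ (i, j)"
  using assms unfolding stage_def by blast+

lemma stageI:
  assumes "sl_congruent d A B" "alternating d B"
    and "\<And>i j. i < d \<Longrightarrow> j < d \<Longrightarrow> i < 2 * k \<or> j < 2 * k \<Longrightarrow> B $$ (i, j) = skew_entry ms i j"
    and "\<And>i j. i \<in> {2*k..<d} \<Longrightarrow> j \<in> {2*k..<d} \<Longrightarrow> g dvd B $$ (i, j)"
  shows "stage d A ms k g B"
  using assms unfolding stage_def by blast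

lemma stage_transvect:
  assumes A: "A \<in> carrier_mat d d" and B: "stage d A ms k g B"
    and ab: "a \<in> {2*k..<d}" "b \<in> {2*k..<d}" "a \<noteq> b"
  shows "stage d A ms k g (transvect d a b c B)"
proof (rule stageI)
  note aB = stage_alternating[OF B]
  have ab': "a < d" "b < d" "2 * k \<le> a" "2 * k \<le> b" using ab by auto
  show "sl_congruent d A (transvect d a b c B)"
    by (rule sl_congruent_trans[OF A stage_congruent[OF B] sl_congruent_transvect[OF aB ab'(1,2) ab(3)]])
  show "alternating d (transvect d a b c B)" by (rule alternating_transvect[OF aB ab'(1,2)])
  show "transvect d a b c B $$ (i, j) = skew_entry ms i j"
    if ij: "i < d" "j < d" "i < 2 * k \<or> j < 2 * k" for i j
  proof -
    have "i = b \<Longrightarrow> B $$ (a, j) = 0" and "j = b \<Longrightarrow> B $$ (i, a) = 0"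
      using ij ab' stage_normal[OF B, of a j] stage_normal[OF B, of i a]
        skew_entry_off[of j k a ms] skew_entry_off[of i k a ms] by auto
    then show ?thesis using stage_normal[OF B ij] ij(1,2) by (simp add: transvect_entry)
  qed
  show "g dvd transvect d a b c B $$ (i, j)"
    if ij: "i \<in> {2*k..<d}" "j \<in> {2*k..<d}" for i j
  proof -
    have "g dvd B $$ (i, j)" "g dvd B $$ (a, j)" "g dvd B $$ (i, a)"
      using stage_dvd[OF B] ij ab by blast+
    then show ?thesis using ij by (simp add: transvect_entry)
  qed
qed

text \<open>Three transvections replace rows \<open>x\<^sub>a, x\<^sub>b\<close> by \<open>x\<^sub>b, - x\<^sub>a\<close>. This is a transposition of
  the basis up to the sign that determinant one forces.\<close>
lemma stage_rotate:
  assumes A: "A \<in> carrier_mat d d" and B: "stage d A ms k g B"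
    and ab: "a \<in> {2*k..<d}" "b \<in> {2*k..<d}" "a \<noteq> b"
  defines "\<sigma> \<equiv> \<lambda>i. if i = b then - 1 else 1 :: int"
  shows "\<exists>B'. stage d A ms k g B' \<and> (\<forall>i<d. \<forall>j<d. B' $$ (i, j) =
    \<sigma> i * \<sigma> j * B $$ (transpose a b i, transpose a b j))"
proof -
  define B1 where "B1 = transvect d a b (- 1) B"
  define B2 where "B2 = transvect d b a 1 B1"
  define B3 where "B3 = transvect d a b (- 1) B2"
  have B1: "stage d A ms k g B1" unfolding B1_def by (rule stage_transvect[OF A B ab])
  have B2: "stage d A ms k g B2" unfolding B2_def by (rule stage_transvect[OF A B1]) (use ab in auto)
  have B3: "stage d A ms k g B3" unfolding B3_def by (rule stage_transvect[OF A B2 ab])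
  have ab': "a < d" "b < d" using ab by auto
  have z: "B $$ (a, a) = 0" "B $$ (b, b) = 0" "B $$ (b, a) = - B $$ (a, b)"
    using alternating_diag alternating_swap stage_alternating[OF B] ab' by blast+
  have "B3 $$ (i, j) = \<sigma> i * \<sigma> j * B $$ (transpose a b i, transpose a b j)"
    if "i < d" "j < d" for i j
    using that ab' ab(3) z unfolding \<sigma>_def
    by (cases "i = a"; cases "i = b"; cases "j = a"; cases "j = b")
      (auto simp: B3_def B2_def B1_def transvect_entry transpose_def)
  then show ?thesis using B3 by blast
qed

text \<open>Rotating twice changes the sign of two basis vectors. With a spare index for \<open>b\<close>, the sign of
  the block that contains \<open>a\<close> can be chosen.\<close>
lemma stage_negate_pair:
  assumes A: "A \<in> carrier_mat d d" and B: "stage d A ms k g B"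
    and ab: "a \<in> {2*k..<d}" "b \<in> {2*k..<d}" "a \<noteq> b"
  defines "\<tau> \<equiv> \<lambda>i. if i = a \<or> i = b then - 1 else 1 :: int"
  shows "\<exists>B'. stage d A ms k g B' \<and> (\<forall>i<d. \<forall>j<d. B' $$ (i, j) = \<tau> i * \<tau> j * B $$ (i, j))"
proof -
  obtain B1 where B1: "stage d A ms k g B1" and e1: "\<forall>i<d. \<forall>j<d. B1 $$ (i, j) =
    (if i = b then - 1 else 1) * (if j = b then - 1 else 1) * B $$ (transpose a b i, transpose a b j)"
    using stage_rotate[OF A B ab] by blast
  obtain B2 where B2: "stage d A ms k g B2" and e2: "\<forall>i<d. \<forall>j<d. B2 $$ (i, j) =
    (if i = b then - 1 else 1) * (if j = b then - 1 else 1) * B1 $$ (transpose a b i, transpose a b j)"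
    using stage_rotate[OF A B1 ab] by blast
  have "B2 $$ (i, j) = \<tau> i * \<tau> j * B $$ (i, j)" if "i < d" "j < d" for i j
  proof -
    have t: "transpose a b i < d" "transpose a b j < d" using ab that by (auto simp: transpose_def)
    have "B2 $$ (i, j) = (if i = b then - 1 else 1) * (if j = b then - 1 else 1) *
      ((if transpose a b i = b then - 1 else 1) * (if transpose a b j = b then - 1 else 1) * B $$ (i, j))"
      using e2 e1 that t by simp
    then show ?thesis using ab(3) unfolding \<tau>_def by (auto simp: transpose_def)
  qed
  then show ?thesis using B2 by blast
qed

text \<open>The minimum runs over all matrices of the stage and not over the entries of a single one, so
  an operation that would produce a smaller nonzero entry refutes it at once.\<close>
definition least_entry :: "nat \<Rightarrow> int mat \<Rightarrow> (nat \<Rightarrow> int) \<Rightarrow> nat \<Rightarrow> int \<Rightarrow> int \<Rightarrow> bool" where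
  "least_entry d A ms k g m \<longleftrightarrow> m > 0 \<and> (\<forall>B. stage d A ms k g B \<longrightarrow>
     (\<forall>i\<in>{2*k..<d}. \<forall>j\<in>{2*k..<d}. B $$ (i, j) \<noteq> 0 \<longrightarrow> m \<le> \<bar>B $$ (i, j)\<bar>))"

lemma least_entryD:
  assumes "least_entry d A ms k g m"
  shows "m > 0" and "stage d A ms k g B \<Longrightarrow> i \<in> {2*k..<d} \<Longrightarrow> j \<in> {2*k..<d}
    \<Longrightarrow> B $$ (i, j) \<noteq> 0 \<Longrightarrow> m \<le> \<bar>B $$ (i, j)\<bar>"
  using assms unfolding least_entry_def by blast+

lemma minimal_pivot:
  assumes A: "A \<in> carrier_mat d d" and B0: "stage d A ms k g B0"
    and ij: "i0 \<in> {2*k..<d}" "j0 \<in> {2*k..<d}" "B0 $$ (i0, j0) \<noteq> 0"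
  obtains m B where "least_entry d A ms k g m" "stage d A ms k g B"
    "\<bar>B $$ (2*k, Suc (2*k))\<bar> = m" "Suc (2*k) < d"
proof -
  let ?I = "{2*k..<d}" and ?p = "2*k" and ?q = "Suc (2*k)"
  define P where "P x \<longleftrightarrow> (\<exists>B i j. stage d A ms k g B \<and> i \<in> ?I \<and> j \<in> ?I
    \<and> B $$ (i, j) \<noteq> 0 \<and> x = nat \<bar>B $$ (i, j)\<bar>)" for x
  have "P (nat \<bar>B0 $$ (i0, j0)\<bar>)" unfolding P_def using B0 ij by blast
  then have least: "P (LEAST x. P x)" by (rule LeastI)
  define m where "m = int (LEAST x. P x)"
  have min: "m \<le> \<bar>B' $$ (i, j)\<bar>"
    if "stage d A ms k g B'" "i \<in> ?I" "j \<in> ?I" "B' $$ (i, j) \<noteq> 0" for B' i j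
  proof -
    have "P (nat \<bar>B' $$ (i, j)\<bar>)" unfolding P_def using that by blast
    then have "(LEAST x. P x) \<le> nat \<bar>B' $$ (i, j)\<bar>" by (rule Least_le)
    then show ?thesis unfolding m_def by linarith
  qed
  obtain B i j where B: "stage d A ms k g B" and i: "i \<in> ?I" and j: "j \<in> ?I"
    and nz: "B $$ (i, j) \<noteq> 0" and m: "(LEAST x. P x) = nat \<bar>B $$ (i, j)\<bar>"
    using least unfolding P_def by blast
  have meq: "m = \<bar>B $$ (i, j)\<bar>" and "m > 0" using m nz unfolding m_def by simp_all
  have neq: "i \<noteq> j" using alternating_diag[OF stage_alternating[OF B]] nz i by auto
  have pd: "?p \<in> ?I" "?q \<in> ?I" using i j neq by auto
  have mv: "\<exists>B'. stage d A ms k g B' \<and> (\<forall>u<d. \<forall>v<d. \<bar>B' $$ (u, v)\<bar> =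
      \<bar>B $$ (transpose a b u, transpose a b v)\<bar>)"
    if "stage d A ms k g B" "a \<in> ?I" "b \<in> ?I" for a b B
  proof (cases "a = b")
    case True
    then show ?thesis using that by auto
  next
    case False
    show ?thesis using stage_rotate[OF A that False] by (fastforce simp: abs_mult)
  qed
  obtain B1 where B1: "stage d A ms k g B1" and e1: "\<forall>u<d. \<forall>v<d. \<bar>B1 $$ (u, v)\<bar> =
      \<bar>B $$ (transpose i ?p u, transpose i ?p v)\<bar>"
    using mv[OF B i pd(1)] by blast
  let ?j = "transpose i ?p j"
  have j': "?j \<in> ?I" "?j \<noteq> ?p" using i j pd neq by (auto simp: transpose_def)
  have "\<bar>B1 $$ (?p, ?j)\<bar> = m" using e1 j' pd meq by simp
  moreover obtain B2 where B2: "stage d A ms k g B2" and e2: "\<forall>u<d. \<forall>v<d. \<bar>B2 $$ (u, v)\<bar> =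
      \<bar>B1 $$ (transpose ?j ?q u, transpose ?j ?q v)\<bar>"
    using mv[OF B1 j'(1) pd(2)] by blast
  moreover have "transpose ?j ?q ?p = ?p" using j' by (auto simp: transpose_def)
  ultimately have "\<bar>B2 $$ (?p, ?q)\<bar> = m" using pd by simp
  moreover have "least_entry d A ms k g m"
    unfolding least_entry_def using \<open>m > 0\<close> min by blast
  ultimately show ?thesis using that B2 pd by auto
qed

text \<open>A transvection replaces the entry at \<open>(x, l)\<close> by its remainder modulo the one at \<open>(x, y)\<close>;
  by minimality the remainder is zero.\<close>
lemma minimal_dvd_row:
  assumes A: "A \<in> carrier_mat d d" and B: "stage d A ms k g B"
    and min: "least_entry d A ms k g m"
    and xyl: "x \<in> {2*k..<d}" "y \<in> {2*k..<d}" "l \<in> {2*k..<d}"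
    and m: "\<bar>B $$ (x, y)\<bar> = m"
  shows "B $$ (x, y) dvd B $$ (x, l)"
proof (rule ccontr)
  assume nd: "\<not> B $$ (x, y) dvd B $$ (x, l)"
  then have "l \<noteq> y" "l \<noteq> x" using alternating_diag[OF stage_alternating[OF B]] xyl by auto
  let ?c = "- (B $$ (x, l) div B $$ (x, y))"
  let ?B = "transvect d y l ?c B"
  have "?B $$ (x, l) = B $$ (x, l) + ?c * B $$ (x, y)"
    using xyl \<open>l \<noteq> x\<close> by (simp add: transvect_entry)
  also have "\<dots> = B $$ (x, l) mod B $$ (x, y)" by (simp add: minus_div_mult_eq_mod)
  finally have e: "?B $$ (x, l) = B $$ (x, l) mod B $$ (x, y)" .
  have "stage d A ms k g ?B" by (rule stage_transvect[OF A B]) (use xyl \<open>l \<noteq> y\<close> in auto)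
  then have "m \<le> \<bar>B $$ (x, l) mod B $$ (x, y)\<bar>"
    using least_entryD(2)[OF min, of ?B x l] e nd xyl by (auto simp: dvd_eq_mod_eq_0)
  moreover have "\<bar>B $$ (x, l) mod B $$ (x, y)\<bar> < \<bar>B $$ (x, y)\<bar>"
    using m least_entryD(1)[OF min] by (intro abs_mod_less) auto
  ultimately show False using m by linarith
qed

lemma clear_pivot_rows:
  assumes A: "A \<in> carrier_mat d d" and B: "stage d A ms k g B"
    and min: "least_entry d A ms k g m"
    and q: "Suc (2*k) < d" and m: "\<bar>B $$ (2*k, Suc (2*k))\<bar> = m"
  shows "L \<le> d \<Longrightarrow> \<exists>B'. stage d A ms k g B' \<and> \<bar>B' $$ (2*k, Suc (2*k))\<bar> = m \<and>
    (\<forall>l. Suc (2*k) < l \<longrightarrow> l < L \<longrightarrow> B' $$ (2*k, l) = 0 \<and> B' $$ (Suc (2*k), l) = 0)"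
proof (induction L)
  case 0
  then show ?case using B m by auto
next
  case (Suc L)
  let ?p = "2*k" and ?q = "Suc (2*k)"
  obtain B1 where B1: "stage d A ms k g B1" and m1: "\<bar>B1 $$ (?p, ?q)\<bar> = m"
    and z1: "\<And>l. ?q < l \<Longrightarrow> l < L \<Longrightarrow> B1 $$ (?p, l) = 0 \<and> B1 $$ (?q, l) = 0"
    using Suc.IH Suc.prems by auto
  show ?case
  proof (cases "?q < L")
    case False
    have "\<not> (?q < l \<and> l < Suc L)" for l using False by auto
    then show ?thesis using B1 m1 by blast
  next
    case True
    have dm: "?p < d" "L < d" "?p \<le> L" "?p \<noteq> L" "?q \<noteq> L" "?p \<noteq> ?q" using True Suc.prems by auto
    note alt1 = stage_alternating[OF B1]
    have "B1 $$ (?p, ?q) dvd B1 $$ (?p, L)"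
      by (rule minimal_dvd_row[OF A B1 min _ _ _ m1]) (use dm q in auto)
    then obtain u where u: "B1 $$ (?p, L) = B1 $$ (?p, ?q) * u" by (elim dvdE)
    have qp: "B1 $$ (?q, ?p) = - B1 $$ (?p, ?q)" using alternating_swap[OF alt1] q dm by blast
    have "B1 $$ (?q, ?p) dvd B1 $$ (?q, L)"
      by (rule minimal_dvd_row[OF A B1 min]) (use dm q m1 qp in auto)
    then obtain v where "B1 $$ (?q, L) = B1 $$ (?q, ?p) * v" by (elim dvdE)
    then have v: "B1 $$ (?q, L) = - B1 $$ (?p, ?q) * v" using qp by simp
    \<comment> \<open>The row of \<open>2 k + 1\<close> clears the entry at \<open>(2 k, L)\<close> and that of \<open>2 k\<close> clears the one at
      \<open>(2 k + 1, L)\<close>; they do not interfere because diagonal entries are zero.\<close>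
    define B2 where "B2 = transvect d ?q L (- u) B1"
    define B3 where "B3 = transvect d ?p L (- v) B2"
    have B2: "stage d A ms k g B2" unfolding B2_def
      by (rule stage_transvect[OF A B1]) (use dm q in auto)
    have B3: "stage d A ms k g B3" unfolding B3_def
      by (rule stage_transvect[OF A B2]) (use dm q in auto)
    have zz: "B1 $$ (?p, ?p) = 0" "B1 $$ (?q, ?q) = 0"
      using alternating_diag[OF alt1] dm q by auto
    have "B3 $$ (?p, ?q) = B1 $$ (?p, ?q)"
      using dm q by (simp add: B3_def B2_def transvect_entry)
    moreover have "B3 $$ (?p, L) = 0" "B3 $$ (?q, L) = 0"
      using dm q zz u v qp by (simp_all add: B3_def B2_def transvect_entry)
    moreover have "B3 $$ (?p, l) = 0" "B3 $$ (?q, l) = 0" if "?q < l" "l < L" for l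
      using that dm q z1[OF that] by (simp_all add: B3_def B2_def transvect_entry)
    ultimately show ?thesis using B3 m1 by (intro exI[of _ B3]) (auto simp: less_Suc_eq)
  qed
qed

lemma skew_entry_update:
  assumes "i < 2 * k \<or> j < 2 * k"
  shows "skew_entry (ms(k := x)) i j = skew_entry ms i j"
proof -
  have "i div 2 \<noteq> k" if "even i" "j = Suc i" using assms that by presburger
  moreover have "j div 2 \<noteq> k" if "even j" "i = Suc j" using assms that by presburger
  ultimately show ?thesis unfolding skew_entry_def by auto
qed

text \<open>One elimination step. Once the two pivot rows are cleared, any other entry can be brought into
  a pivot row without changing the pivot, by adding its row; so the pivot divides it. The sign of
  the block is free as long as there is an index beyond the block.\<close>
lemma stage_extend:
  assumes A: "A \<in> carrier_mat d d" and B0: "stage d A ms k g B0" and q: "Suc (2*k) < d"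
  shows "\<exists>x B. g dvd x \<and> stage d A (ms(k := x)) (Suc k) x B \<and> (Suc (Suc (2*k)) < d \<longrightarrow> x \<ge> 0)"
proof (cases "\<exists>i\<in>{2*k..<d}. \<exists>j\<in>{2*k..<d}. B0 $$ (i, j) \<noteq> 0")
  case False
  then have z: "B0 $$ (i, j) = 0" if "2*k \<le> i" "i < d" "2*k \<le> j" "j < d" for i j using that by auto
  have "B0 $$ (i, j) = skew_entry (ms(k := 0)) i j"
    if "i < d" "j < d" "i < 2 * Suc k \<or> j < 2 * Suc k" for i j
  proof (cases "i < 2*k \<or> j < 2*k")
    case True
    then show ?thesis using that stage_normal[OF B0] skew_entry_update[OF True] by simp
  next
    case F: False
    then have "B0 $$ (i, j) = 0" using z that by auto
    moreover have "skew_entry (ms(k := 0)) i j = 0"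
      using F that(3) by (auto simp: skew_entry_def)
    ultimately show ?thesis by simp
  qed
  then have "stage d A (ms(k := 0)) (Suc k) 0 B0"
    using z by (intro stageI stage_congruent[OF B0] stage_alternating[OF B0]) auto
  then show ?thesis by (intro exI[of _ 0] exI[of _ B0]) auto
next
  case True
  let ?p = "2*k" and ?q = "Suc (2*k)" and ?I = "{2*k..<d}"
  obtain i0 j0 where ij0: "i0 \<in> ?I" "j0 \<in> ?I" "B0 $$ (i0, j0) \<noteq> 0" using True by blast
  obtain m B1 where min: "least_entry d A ms k g m" and B1: "stage d A ms k g B1"
    and m1: "\<bar>B1 $$ (?p, ?q)\<bar> = m"
    using minimal_pivot[OF A B0 ij0] by blast
  obtain B2 where B2: "stage d A ms k g B2" and m2: "\<bar>B2 $$ (?p, ?q)\<bar> = m"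
    and z2: "\<And>l. ?q < l \<Longrightarrow> l < d \<Longrightarrow> B2 $$ (?p, l) = 0 \<and> B2 $$ (?q, l) = 0"
    using clear_pivot_rows[OF A B1 min q m1 order_refl] by blast
  obtain B where B: "stage d A ms k g B" and mB: "\<bar>B $$ (?p, ?q)\<bar> = m"
    and zB: "\<And>l. ?q < l \<Longrightarrow> l < d \<Longrightarrow> B $$ (?p, l) = 0 \<and> B $$ (?q, l) = 0"
    and sgn: "Suc ?q < d \<Longrightarrow> B $$ (?p, ?q) \<ge> 0"
  proof (cases "Suc ?q < d \<and> B2 $$ (?p, ?q) < 0")
    case True
    have "\<exists>B'. stage d A ms k g B' \<and> (\<forall>i<d. \<forall>j<d. B' $$ (i, j) =
      (if i = ?q \<or> i = Suc ?q then - 1 else 1) * (if j = ?q \<or> j = Suc ?q then - 1 else 1)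
        * B2 $$ (i, j))"
      by (rule stage_negate_pair[OF A B2]) (use True in auto)
    then obtain B3 where "stage d A ms k g B3" "\<And>i j. i < d \<Longrightarrow> j < d \<Longrightarrow> B3 $$ (i, j) =
      (if i = ?q \<or> i = Suc ?q then - 1 else 1) * (if j = ?q \<or> j = Suc ?q then - 1 else 1)
        * B2 $$ (i, j)" by blast
    then show ?thesis using that[of B3] True m2 z2 by simp
  next
    case False
    then show ?thesis using that[OF B2 m2 z2] by auto
  qed
  let ?x = "B $$ (?p, ?q)"
  note alt = stage_alternating[OF B]
  have pd: "?p \<in> ?I" "?q \<in> ?I" using q by auto
  have "?x dvd B $$ (i, j)" if ij: "i \<in> {2 * Suc k..<d}" "j \<in> {2 * Suc k..<d}" for i j
  proof -
    let ?B = "transvect d i ?p 1 B"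
    have st: "stage d A ms k g ?B" by (rule stage_transvect[OF A B]) (use ij pd in auto)
    have iq: "B $$ (i, ?q) = 0" using alternating_swap[OF alt, of i ?q] zB[of i] ij q by auto
    have 1: "?B $$ (?p, ?q) = ?x" using iq q by (simp add: transvect_entry)
    have "?B $$ (?p, ?q) dvd ?B $$ (?p, j)"
      by (rule minimal_dvd_row[OF A st min]) (use ij pd mB 1 in auto)
    moreover have "?B $$ (?p, j) = B $$ (i, j)"
      using ij q zB[of j] by (auto simp: transvect_entry)
    ultimately show ?thesis using 1 by simp
  qed
  moreover have "B $$ (i, j) = skew_entry (ms(k := ?x)) i j"
    if ij: "i < d" "j < d" and or: "i < 2 * Suc k \<or> j < 2 * Suc k" for i j
  proof (cases "i < 2*k \<or> j < 2*k")
    case True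
    then show ?thesis using ij stage_normal[OF B] skew_entry_update[OF True] by simp
  next
    case F: False
    have row: "B $$ (u, v) = skew_entry (ms(k := ?x)) u v"
      if "u = ?p \<or> u = ?q" "?p \<le> v" "v < d" for u v
    proof -
      have d: "B $$ (?p, ?p) = 0" "B $$ (?q, ?q) = 0" "B $$ (?q, ?p) = - ?x"
        using alternating_diag[OF alt] alternating_swap[OF alt, of ?q ?p] q by simp_all
      show ?thesis
      proof (cases "?q < v")
        case True
        then have "B $$ (u, v) = 0" using that zB[of v] by auto
        moreover have "skew_entry (ms(k := ?x)) u v = 0"
          using True that by (auto simp: skew_entry_def)
        ultimately show ?thesis by simp
      next
        case False
        then have "v = ?p \<or> v = ?q" using \<open>?p \<le> v\<close> by arith
        then show ?thesis using that(1) d by (elim disjE) (simp_all add: skew_entry_def)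
      qed
    qed
    have "(i = ?p \<or> i = ?q) \<or> (j = ?p \<or> j = ?q)" using F or by arith
    then show ?thesis
    proof
      assume 1: "i = ?p \<or> i = ?q"
      show ?thesis using row[OF 1, of j] F ij by linarith
    next
      assume 2: "j = ?p \<or> j = ?q"
      have "B $$ (j, i) = skew_entry (ms(k := ?x)) j i" using row[OF 2, of i] F ij by linarith
      then show ?thesis using alternating_swap[OF alt ij] skew_entry_antisym[of _ i j] by simp
    qed
  qed
  ultimately have "stage d A (ms(k := ?x)) (Suc k) ?x B"
    by (intro stageI stage_congruent[OF B] alt)
  moreover have "g dvd ?x" using stage_dvd[OF B pd] .
  ultimately show ?thesis using sgn by blast
qed

text \<open>The elementary divisor theorem for alternating integer matrices, under congruence by
  determinant one. For even \<open>d\<close> the Pfaffian is an invariant, so the sign of the last block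
  cannot be prescribed.\<close>
theorem skew_normal_form:
  assumes A: "alternating d A"
  shows "\<exists>C ms. sl_congruent d A C \<and> C \<in> carrier_mat d d
    \<and> (\<forall>i<d. \<forall>j<d. C $$ (i, j) = skew_entry ms i j)
    \<and> (\<forall>i. ms i dvd ms (Suc i)) \<and> (\<forall>i. d \<le> 2 * i + 1 \<longrightarrow> ms i = 0)
    \<and> (\<forall>i. 2 * i + 2 < d \<longrightarrow> ms i \<ge> 0)"
proof -
  have cA: "A \<in> carrier_mat d d" using A unfolding alternating_def by blast
  have "\<exists>ms g B. stage d A ms k g B \<and> (\<forall>i. Suc i < k \<longrightarrow> ms i dvd ms (Suc i))
    \<and> (\<forall>i<k. i + 1 = k \<longrightarrow> ms i = g) \<and> (\<forall>i<k. 2 * i + 2 < d \<longrightarrow> ms i \<ge> 0)" if "2 * k \<le> d" for k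
    using that
  proof (induction k)
    case 0
    have "stage d A (\<lambda>_. 0) 0 1 A" by (intro stageI A sl_congruent_refl[OF cA]) auto
    then show ?case by auto
  next
    case (Suc k)
    then obtain ms g B where B: "stage d A ms k g B" "\<forall>i. Suc i < k \<longrightarrow> ms i dvd ms (Suc i)"
      "\<forall>i<k. i + 1 = k \<longrightarrow> ms i = g" "\<forall>i<k. 2 * i + 2 < d \<longrightarrow> ms i \<ge> 0" by auto
    obtain x B' where x: "g dvd x" "stage d A (ms(k := x)) (Suc k) x B'"
      "Suc (Suc (2*k)) < d \<longrightarrow> x \<ge> 0"
      using stage_extend[OF cA B(1)] Suc.prems by auto
    show ?case
      by (intro exI[of _ "ms(k := x)"] exI[of _ x] exI[of _ B'] conjI x(2))
        (use B x in \<open>auto simp: less_Suc_eq\<close>)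
  qed
  from this[of "d div 2"] obtain ms g C where C: "stage d A ms (d div 2) g C"
    "\<forall>i. Suc i < d div 2 \<longrightarrow> ms i dvd ms (Suc i)" "\<forall>i<d div 2. 2 * i + 2 < d \<longrightarrow> ms i \<ge> 0" by auto
  \<comment> \<open>Beyond the last full block the values are set to zero, which continues the chain of
    divisors.\<close>
  define ms' where "ms' i = (if 2 * i + 1 < d then ms i else 0)" for i
  have "C \<in> carrier_mat d d"
    using stage_alternating[OF C(1)] unfolding alternating_def by blast
  moreover have "C $$ (i, j) = skew_entry ms' i j" if ij: "i < d" "j < d" for i j
  proof (cases "i < 2 * (d div 2) \<or> j < 2 * (d div 2)")
    case True
    have "skew_entry ms i j = skew_entry ms' i j"
      using ij by (simp add: skew_entry_def ms'_def)
    then show ?thesis using stage_normal[OF C(1) ij True] by simp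
  next
    case False
    then have "i = j" using ij by presburger
    then show ?thesis using alternating_diag[OF stage_alternating[OF C(1)]] ij
      by (simp add: skew_entry_def)
  qed
  moreover have "ms' i dvd ms' (Suc i)" for i
  proof (cases "2 * i + 3 < d")
    case True
    then have "Suc i < d div 2" by linarith
    then have "ms i dvd ms (Suc i)" using C(2) by blast
    then show ?thesis using True by (simp add: ms'_def)
  qed (simp add: ms'_def)
  moreover have "ms' i = 0" if "2 * i + 1 \<ge> d" for i using that by (simp add: ms'_def)
  moreover have "ms' i \<ge> 0" if "2 * i + 2 < d" for i
  proof -
    have "i < d div 2" using that by linarith
    then show ?thesis using C(3) that by (simp add: ms'_def)
  qed
  ultimately show ?thesis using stage_congruent[OF C(1)]
    by (intro exI[of _ C] exI[of _ ms'] conjI allI impI)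
qed

section \<open>Reading off the block entries\<close>

lemma congruence_entry:
  fixes W A :: "int mat"
  assumes "W \<in> carrier_mat d d" "A \<in> carrier_mat d d" "i < d" "j < d"
  shows "(W * A * transpose_mat W) $$ (i, j)
    = (\<Sum>l<d. \<Sum>k<d. W $$ (i, k) * A $$ (k, l) * W $$ (j, l))"
  using assms by (auto simp: times_mat_def scalar_prod_def sum_distrib_right atLeast0LessThan
      intro!: sum.cong)

lemma mult_entry:
  fixes X Y :: "int mat"
  assumes "X \<in> carrier_mat d d" "Y \<in> carrier_mat d d" "i < d" "j < d"
  shows "(X * Y) $$ (i, j) = (\<Sum>k<d. X $$ (i, k) * Y $$ (k, j))"
  using assms by (auto simp: times_mat_def scalar_prod_def atLeast0LessThan intro!: sum.cong)

lemma sum_diag_mult_commute: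
  fixes X Y :: "int mat"
  assumes "X \<in> carrier_mat d d" "Y \<in> carrier_mat d d"
  shows "(\<Sum>k<d. (X * Y) $$ (k, k)) = (\<Sum>k<d. (Y * X) $$ (k, k))"
proof -
  have "(\<Sum>k<d. (X * Y) $$ (k, k)) = (\<Sum>k<d. \<Sum>l<d. X $$ (k, l) * Y $$ (l, k))"
    by (intro sum.cong refl mult_entry[OF assms]) auto
  also have "\<dots> = (\<Sum>l<d. \<Sum>k<d. Y $$ (l, k) * X $$ (k, l))"
    by (subst sum.swap) (simp add: mult.commute)
  also have "\<dots> = (\<Sum>l<d. (Y * X) $$ (l, l))"
    by (intro sum.cong refl mult_entry[OF assms(2,1), symmetric]) auto
  finally show ?thesis .
qed

lemma SL_inverse:
  fixes W :: "int mat"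
  assumes "W \<in> carrier_mat d d" "det W = 1"
  obtains V where "V \<in> carrier_mat d d" "W * V = 1\<^sub>m d" "V * W = 1\<^sub>m d"
proof (rule that)
  have one: "(1::int) \<cdot>\<^sub>m 1\<^sub>m d = 1\<^sub>m d" by (intro eq_matI) auto
  show "adj_mat W \<in> carrier_mat d d" "W * adj_mat W = 1\<^sub>m d" "adj_mat W * W = 1\<^sub>m d"
    using adj_mat[OF assms(1)] assms(2) one by simp_all
qed

text \<open>A half inverse, that is a \<open>K\<close> with \<open>A K A = 2 A\<close>, moves along a congruence \<open>W\<close> as
  \<open>W\<^sup>-\<^sup>T K W\<^sup>-\<^sup>1\<close>, and the product \<open>A K\<close> is thereby conjugated, so its trace is kept.\<close>
lemma half_inverse_congruence:
  assumes A: "A \<in> carrier_mat d d" and K: "K \<in> carrier_mat d d"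
    and AKA: "A * K * A = 2 \<cdot>\<^sub>m A" and "sl_congruent d A C"
  obtains L where "L \<in> carrier_mat d d" "C * L * C = 2 \<cdot>\<^sub>m C"
    "(\<Sum>k<d. (C * L) $$ (k, k)) = (\<Sum>k<d. (A * K) $$ (k, k))"
proof -
  obtain W where W: "W \<in> carrier_mat d d" "det W = 1" and C: "C = W * A * transpose_mat W"
    using assms(4) unfolding sl_congruent_def by blast
  obtain V where V: "V \<in> carrier_mat d d" "W * V = 1\<^sub>m d" "V * W = 1\<^sub>m d"
    by (rule SL_inverse[OF W])
  let ?Wt = "transpose_mat W" and ?Vt = "transpose_mat V"
  have t: "?Wt \<in> carrier_mat d d" "?Vt \<in> carrier_mat d d" using W V by auto
  have WV: "?Wt * ?Vt = 1\<^sub>m d" using transpose_mult[OF V(1) W(1)] V(3) by simp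
  define L where "L = ?Vt * (K * V)"
  note assoc = assoc_mult_mat[of _ d d _ d _ d]
  have L: "L \<in> carrier_mat d d" using t K V unfolding L_def by auto
  have "C * L = W * A * (?Wt * ?Vt) * (K * V)"
    unfolding C L_def using W A t K V by (simp add: assoc)
  then have CL: "C * L = W * (A * K) * V" using WV W A K V by (simp add: assoc)
  have "C * L * C = W * (A * K) * V * C" unfolding CL ..
  also have "\<dots> = W * (A * K) * (V * W) * (A * ?Wt)"
    unfolding C using W(1) A t K V(1) by (simp add: assoc)
  also have "\<dots> = W * (A * K * A) * ?Wt" unfolding V(3) using W A t K by (simp add: assoc)
  also have "\<dots> = 2 \<cdot>\<^sub>m C" unfolding AKA C
    using W A t by (simp add: mult_smult_distrib[of _ d d _ d] mult_smult_assoc_mat[of _ d d _ d])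
  finally have CLC: "C * L * C = 2 \<cdot>\<^sub>m C" .
  have "(\<Sum>k<d. (C * L) $$ (k, k)) = (\<Sum>k<d. (W * (A * K * V)) $$ (k, k))"
    unfolding CL using W A K V by (simp add: assoc)
  also have "\<dots> = (\<Sum>k<d. ((A * K * V) * W) $$ (k, k))"
    by (rule sum_diag_mult_commute) (use W A K V in auto)
  also have "(A * K * V) * W = A * K" using W A K V by (simp add: assoc)
  finally show ?thesis using that L CLC by blast
qed

lemma sum_skew_row:
  assumes "i < d"
  shows "(\<Sum>k<d. skew_entry ms i k * f k) = (if even i then (if Suc i < d then ms (i div 2) * f (Suc i) else 0)
    else - ms (i div 2) * f (i - 1))"
proof (cases "even i")
  case True
  have "(\<Sum>k<d. skew_entry ms i k * f k) = (\<Sum>k<d. if k = Suc i then ms (i div 2) * f (Suc i) else 0)"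
    using True by (intro sum.cong) (auto simp: skew_entry_def)
  then show ?thesis using True by simp
next
  case False
  then obtain h where h: "i = Suc (2 * h)" by (auto elim: oddE)
  have "(\<Sum>k<d. skew_entry ms i k * f k) = (\<Sum>k<d. if k = 2 * h then - ms h * f (2 * h) else 0)"
    using h by (intro sum.cong) (auto simp: skew_entry_def)
  then show ?thesis using h assms by simp
qed

text \<open>In one block \<open>m J\<close> of the normal form, with \<open>J = (0, 1; - 1, 0)\<close>, the equation \<open>C L C = 2 C\<close>
  compares \<open>m\<^sup>2\<close> times an integer with \<open>2 m\<close>, whence \<open>m\<close> divides \<open>2\<close> unless it is zero. The
  diagonal of \<open>C L\<close> carries a \<open>2\<close> for each row of a nonzero block, so its trace counts them.\<close>
lemma half_inverse_normal_form:
  assumes C: "C \<in> carrier_mat d d" and L: "L \<in> carrier_mat d d"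
    and CLC: "C * L * C = 2 \<cdot>\<^sub>m C"
    and nf: "\<And>i j. i < d \<Longrightarrow> j < d \<Longrightarrow> C $$ (i, j) = skew_entry ms i j"
    and out: "\<And>i. 2 * i + 1 \<ge> d \<Longrightarrow> ms i = 0"
  shows "ms i dvd 2 \<or> ms i = 0"
    and "k < d \<Longrightarrow> (C * L) $$ (k, k) = (if ms (k div 2) = 0 then 0 else 2)"
proof -
  have CL: "C * L \<in> carrier_mat d d" using C L by auto
  have row: "(C * L) $$ (k, j) = (\<Sum>l<d. skew_entry ms k l * L $$ (l, j))" if "k < d" "j < d" for k j
    using that nf by (simp add: mult_entry[OF C L])
  have two: "(C * L) $$ (k, k) = 2" if k: "k < d" and nz: "ms (k div 2) \<noteq> 0" for k
  proof -
    define j where "j = (if even k then Suc k else k - 1)"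
    have "2 * (k div 2) + 1 < d" using out nz by (meson not_le)
    then have jd: "j < d" using k unfolding j_def by auto
    have kd: "(if even j then Suc j else j - 1) = k" "j div 2 = k div 2" "even j \<longleftrightarrow> odd k"
      unfolding j_def by (auto elim!: evenE oddE)
    have "2 * C $$ (k, j) = (C * L * C) $$ (k, j)" unfolding CLC using C k jd by simp
    also have "\<dots> = (\<Sum>l<d. (C * L) $$ (k, l) * skew_entry ms l j)"
      using k jd nf by (simp add: mult_entry[OF CL C])
    also have "\<dots> = - (\<Sum>l<d. skew_entry ms j l * (C * L) $$ (k, l))"
      by (simp add: skew_entry_antisym[of ms _ j] mult.commute flip: sum_negf)
    also have "\<dots> = skew_entry ms k j * (C * L) $$ (k, k)"
      using sum_skew_row[OF jd, of ms "\<lambda>l. (C * L) $$ (k, l)"] k kd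
      by (cases "even k") (auto simp: j_def skew_entry_def elim!: evenE oddE)
    finally have "2 * skew_entry ms k j = skew_entry ms k j * (C * L) $$ (k, k)"
      using nf k jd by simp
    moreover have "skew_entry ms k j \<noteq> 0"
      using nz unfolding skew_entry_def j_def by (auto elim!: evenE oddE)
    ultimately show ?thesis by simp
  qed
  show "(C * L) $$ (k, k) = (if ms (k div 2) = 0 then 0 else 2)" if k: "k < d"
    using two[OF k] row[OF k k] sum_skew_row[OF k, of ms "\<lambda>l. L $$ (l, k)"] by auto
  show "ms i dvd 2 \<or> ms i = 0"
  proof (rule disjCI)
    assume nz: "ms i \<noteq> 0"
    then have i: "2 * i + 1 < d" using out by (meson not_le)
    have "2 = (C * L) $$ (2 * i, 2 * i)" using two[of "2 * i"] nz i by simp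
    also have "\<dots> = ms i * L $$ (Suc (2 * i), 2 * i)"
      using row[of "2 * i" "2 * i"] sum_skew_row[of "2 * i" d ms "\<lambda>l. L $$ (l, 2 * i)"] i by simp
    finally show "ms i dvd 2" by (rule dvdI)
  qed
qed

section \<open>Block diagonal matrices by entries\<close>

lemma skew_entry_Suc_Suc:
  "skew_entry f (Suc (Suc i)) (Suc (Suc j)) = skew_entry (\<lambda>k. f (Suc k)) i j"
  unfolding skew_entry_def by auto

lemma diag_block_mat_replicate_zero:
  "diag_block_mat (replicate z (0\<^sub>m 1 1)) = (0\<^sub>m z z :: int mat)"
  by (induction z) (auto simp: Let_def intro!: eq_matI)

lemma skew_block_entries:
  "skew_block m = mat 2 2 (\<lambda>(i, j). skew_entry (\<lambda>_. - m) i j)"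
  unfolding skew_block_def mat_of_rows_list_def
  by (intro eq_matI) (auto simp: skew_entry_def less_2_cases_iff)

lemma diag_block_mat_skew:
  "diag_block_mat (map skew_block xs @ replicate z (0\<^sub>m 1 1)) =
    mat (2 * length xs + z) (2 * length xs + z)
      (\<lambda>(i, j). skew_entry (\<lambda>i. if i < length xs then - (xs ! i) else 0) i j)"
proof (induction xs)
  case Nil
  show ?case using diag_block_mat_replicate_zero[of z]
    by (intro eq_matI) (auto simp: skew_entry_def)
next
  case (Cons x xs)
  define f where "f = (\<lambda>i. if i < length (x # xs) then - ((x # xs) ! i) else 0)"
  have f0: "f 0 = - x" and fS: "(\<lambda>k. f (Suc k)) = (\<lambda>i. if i < length xs then - (xs ! i) else 0)"
    by (auto simp: f_def)
  have e: "skew_entry f i j = (if i < 2 then if j < 2 then skew_entry (\<lambda>_. - x) i j else 0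
      else if j < 2 then 0
      else skew_entry (\<lambda>i. if i < length xs then - (xs ! i) else 0) (i - 2) (j - 2))" for i j
  proof -
    consider "i < 2" | "2 \<le> i" "j < 2" | "2 \<le> i" "2 \<le> j" by linarith
    then show ?thesis
    proof cases
      case 3
      then obtain i' j' where "i = Suc (Suc i')" "j = Suc (Suc j')"
        by (metis add_2_eq_Suc le_Suc_ex)
      then show ?thesis using skew_entry_Suc_Suc[of f i' j'] fS by simp
    qed (auto simp: skew_entry_def less_2_cases_iff f0)
  qed
  show ?case
    unfolding list.map append_Cons diag_block_mat.simps(2) Cons.IH Let_def
    unfolding skew_block_entries f_def[symmetric]
    by (intro eq_matI) (auto simp: e)
qed

text \<open>Trailing \<open>1 \<times> 1\<close> zero blocks are regrouped in pairs into \<open>2 \<times> 2\<close> zero blocks, which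
  leaves at most one of them.\<close>
lemma canonical_shape_skew:
  "canonical_shape (diag_block_mat (map skew_block xs @ replicate z (0\<^sub>m 1 1)))"
proof -
  let ?C = "diag_block_mat (map skew_block xs @ replicate z (0\<^sub>m 1 1))"
  define ys where "ys = xs @ replicate (z div 2) 0"
  have f: "(\<lambda>i. if i < length ys then - (ys ! i) else 0)
      = (\<lambda>i. if i < length xs then - (xs ! i) else 0)"
    by (auto simp: ys_def nth_append)
  have "2 * length ys + z mod 2 = 2 * length xs + z" by (simp add: ys_def)
  then have C: "?C = diag_block_mat (map skew_block ys @ replicate (z mod 2) (0\<^sub>m 1 1))"
    unfolding diag_block_mat_skew f by simp
  show ?thesis
  proof (cases "even z")
    case True
    then have "z mod 2 = 0" by presburger
    then show ?thesis using C unfolding canonical_shape_def by (intro exI[of _ ys]) simp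
  next
    case False
    then have "z mod 2 = Suc 0" by presburger
    then show ?thesis using C unfolding canonical_shape_def by (intro exI[of _ ys]) simp
  qed
qed

lemma D_block_skew: "D_block j = skew_block (if j = 1 then - 1 else - 2)"
  unfolding D_block_def skew_block_def by simp

section \<open>The form on square grids\<close>

type_synonym grid = "nat \<Rightarrow> nat \<Rightarrow> int"

definition unit_grid :: "nat \<Rightarrow> nat \<Rightarrow> grid" where
  "unit_grid i j = (\<lambda>s t. if s = i \<and> t = j then 1 else 0)"

definition grid_exp :: "nat \<Rightarrow> nat \<Rightarrow> nat \<Rightarrow> nat \<Rightarrow> int" where
  "grid_exp i j s t = (int s + int t - int i - int j)
     - 2 * (if i < s \<and> j < t then 1 else 0) + 2 * (if s < i \<and> t < j then 1 else 0)"

lemma h_exp_lex_pair: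
  "h_exp (lex_pair n k) (lex_pair n l) = grid_exp (k div n) (k mod n) (l div n) (l mod n)"
proof -
  have "h_exp (int i + 1, int j + 1) (int s + 1, int t + 1) = grid_exp i j s t" for i j s t
    unfolding h_exp_def grid_exp_def by (auto simp: mult_le_0_iff)
  then show ?thesis unfolding lex_pair_def by blast
qed

definition form_op :: "nat \<Rightarrow> grid \<Rightarrow> grid" where
  "form_op n X i j = (\<Sum>s<n. \<Sum>t<n. grid_exp i j s t * X s t)"

text \<open>Inverse to taking cumulative sums over rectangles with a corner at the origin. Tables of
  cumulative sums are good coordinates because the dominance sums in the form become values of
  the table: the form compares a table with its own diagonal shift.\<close>
definition mixed_diff :: "grid \<Rightarrow> grid" where
  "mixed_diff R s t = R (Suc s) (Suc t) - R s (Suc t) - R (Suc s) t + R s t"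

lemma sum_mixed_diff_rectangle:
  assumes "a \<le> a'" "b \<le> b'"
  shows "(\<Sum>s=a..<a'. \<Sum>t=b..<b'. mixed_diff R s t) = R a' b' - R a b' - R a' b + R a b"
proof -
  have "(\<Sum>t=b..<b'. mixed_diff R s t) = (R (Suc s) b' - R (Suc s) b) - (R s b' - R s b)" for s
  proof -
    have "(\<Sum>t=b..<b'. mixed_diff R s t)
        = (\<Sum>t=b..<b'. (R (Suc s) (Suc t) - R s (Suc t)) - (R (Suc s) t - R s t))"
      by (simp add: mixed_diff_def algebra_simps)
    also have "\<dots> = (R (Suc s) b' - R s b') - (R (Suc s) b - R s b)"
      by (rule sum_Suc_diff'[OF assms(2)])
    finally show ?thesis by simp
  qed
  then have "(\<Sum>s=a..<a'. \<Sum>t=b..<b'. mixed_diff R s t)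
      = (\<Sum>s=a..<a'. (R (Suc s) b' - R (Suc s) b) - (R s b' - R s b))" by simp
  also have "\<dots> = (R a' b' - R a' b) - (R a b' - R a b)" by (rule sum_Suc_diff'[OF assms(1)])
  finally show ?thesis by simp
qed

lemma sum_mixed_diff:
  assumes "\<And>j. R 0 j = 0" "\<And>i. R i 0 = 0"
  shows "(\<Sum>s<a. \<Sum>t<b. mixed_diff R s t) = R a b"
  using sum_mixed_diff_rectangle[of 0 a 0 b R] assms by (simp add: atLeast0LessThan)

lemma sum_times_diff:
  "(\<Sum>s<n. int s * (f (Suc s) - f s)) = int n * f n - (\<Sum>s<n. f (Suc s))"
  by (induction n) (auto simp: algebra_simps)

lemma sum_box_indicator:
  fixes X :: grid
  assumes "A \<subseteq> {..<n}" "B \<subseteq> {..<n}"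
  shows "(\<Sum>s<n. \<Sum>t<n. (if s \<in> A \<and> t \<in> B then 1 else 0) * X s t) = (\<Sum>s\<in>A. \<Sum>t\<in>B. X s t)"
proof -
  have "(\<Sum>t<n. (if s \<in> A \<and> t \<in> B then 1 else 0) * X s t)
      = (if s \<in> A then \<Sum>t\<in>B. X s t else 0)" for s
  proof -
    have "(\<Sum>t<n. (if s \<in> A \<and> t \<in> B then 1 else 0) * X s t)
        = (\<Sum>t<n. if t \<in> B then (if s \<in> A then X s t else 0) else 0)"
      by (intro sum.cong) auto
    also have "\<dots> = (\<Sum>t\<in>{..<n} \<inter> B. if s \<in> A then X s t else 0)"
      by (rule sum.inter_restrict[symmetric]) simp
    also have "{..<n} \<inter> B = B" using assms(2) by blast
    finally show ?thesis by simp
  qed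
  then have "(\<Sum>s<n. \<Sum>t<n. (if s \<in> A \<and> t \<in> B then 1 else 0) * X s t)
      = (\<Sum>s\<in>{..<n} \<inter> A. \<Sum>t\<in>B. X s t)" by (simp add: sum.inter_restrict)
  also have "{..<n} \<inter> A = A" using assms(1) by blast
  finally show ?thesis .
qed

text \<open>The sum of \<open>(s + t) X\<^bsub>s,t\<^esub>\<close> over the grid, after summation by parts for
  \<open>X = mixed_diff R\<close>.\<close>
definition moment :: "nat \<Rightarrow> grid \<Rightarrow> int" where
  "moment n R = 2 * int n * R n n - (\<Sum>s<n. R (Suc s) n) - (\<Sum>t<n. R n (Suc t))"

text \<open>The linear part of the exponent contributes the moment and the total \<open>R n n\<close>. The other two
  terms sum \<open>X\<close> over the positions strictly above and strictly below \<open>(i, j)\<close>, which are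
  rectangles. Apart from boundary values of \<open>R\<close>, only the difference of two neighbours on a
  diagonal is left.\<close>
lemma form_op_mixed_diff:
  assumes R0: "\<And>j. R 0 j = 0" "\<And>i. R i 0 = 0" and ij: "i < n" "j < n"
  shows "form_op n (mixed_diff R) i j = moment n R - (int i + int j) * R n n
    - 2 * (R (Suc i) (Suc j) - R i j - R (Suc i) n - R n (Suc j) + R n n)"
proof -
  let ?X = "mixed_diff R"
  have split: "grid_exp i j s t * ?X s t = int s * ?X s t + int t * ?X s t
      - (int i + int j) * ?X s t
      - 2 * ((if s \<in> {Suc i..<n} \<and> t \<in> {Suc j..<n} then 1 else 0) * ?X s t)
      + 2 * ((if s \<in> {0..<i} \<and> t \<in> {0..<j} then 1 else 0) * ?X s t)"
    if "s < n" "t < n" for s t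
    using that by (auto simp: grid_exp_def algebra_simps)
  have rows: "(\<Sum>t<n. ?X s t) = R (Suc s) n - R s n" for s
    using sum_mixed_diff_rectangle[of s "Suc s" 0 n R] R0 by (simp add: atLeast0LessThan)
  have cols: "(\<Sum>s<n. ?X s t) = R n (Suc t) - R n t" for t
    using sum_mixed_diff_rectangle[of 0 n t "Suc t" R] R0 by (simp add: atLeast0LessThan)
  have S: "(\<Sum>s<n. \<Sum>t<n. int s * ?X s t) = int n * R n n - (\<Sum>s<n. R (Suc s) n)"
    using sum_times_diff[of "\<lambda>s. R s n" n] by (simp add: rows flip: sum_distrib_left)
  have "(\<Sum>s<n. \<Sum>t<n. int t * ?X s t) = (\<Sum>t<n. \<Sum>s<n. int t * ?X s t)" by (rule sum.swap)
  then have T: "(\<Sum>s<n. \<Sum>t<n. int t * ?X s t) = int n * R n n - (\<Sum>t<n. R n (Suc t))"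
    using sum_times_diff[of "\<lambda>t. R n t" n] by (simp add: cols flip: sum_distrib_left)
  have U: "(\<Sum>s<n. \<Sum>t<n. (if s \<in> {Suc i..<n} \<and> t \<in> {Suc j..<n} then 1 else 0) * ?X s t)
      = R n n - R (Suc i) n - R n (Suc j) + R (Suc i) (Suc j)"
    by (subst sum_box_indicator) (use ij sum_mixed_diff_rectangle[of "Suc i" n "Suc j" n R] in auto)
  have L: "(\<Sum>s<n. \<Sum>t<n. (if s \<in> {0..<i} \<and> t \<in> {0..<j} then 1 else 0) * ?X s t) = R i j"
    by (subst sum_box_indicator) (use ij R0 sum_mixed_diff_rectangle[of 0 i 0 j R] in auto)
  have "form_op n ?X i j = (\<Sum>s<n. \<Sum>t<n. int s * ?X s t + int t * ?X s t
      - (int i + int j) * ?X s t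
      - 2 * ((if s \<in> {Suc i..<n} \<and> t \<in> {Suc j..<n} then 1 else 0) * ?X s t)
      + 2 * ((if s \<in> {0..<i} \<and> t \<in> {0..<j} then 1 else 0) * ?X s t))"
    unfolding form_op_def by (intro sum.cong refl split) auto
  also have "\<dots> = (\<Sum>s<n. \<Sum>t<n. int s * ?X s t) + (\<Sum>s<n. \<Sum>t<n. int t * ?X s t)
      - (int i + int j) * (\<Sum>s<n. \<Sum>t<n. ?X s t)
      - 2 * (\<Sum>s<n. \<Sum>t<n. (if s \<in> {Suc i..<n} \<and> t \<in> {Suc j..<n} then 1 else 0) * ?X s t)
      + 2 * (\<Sum>s<n. \<Sum>t<n. (if s \<in> {0..<i} \<and> t \<in> {0..<j} then 1 else 0) * ?X s t)"
    by (simp only: sum.distrib sum_subtractf sum_distrib_left)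
  also have "(\<Sum>s<n. \<Sum>t<n. ?X s t) = R n n" using sum_mixed_diff[of R n n] R0 by blast
  finally show ?thesis unfolding S T U L moment_def by (simp add: algebra_simps)
qed

lemma mixed_diff_prefix_sum:
  fixes X :: grid
  defines "R \<equiv> \<lambda>i j. \<Sum>s<i. \<Sum>t<j. X s t"
  shows "mixed_diff R = X"
  by (intro ext) (simp add: mixed_diff_def R_def sum.distrib)

lemma sum_unit_grid:
  fixes G :: grid
  assumes "i < n" "j < n"
  shows "(\<Sum>s<n. \<Sum>t<n. unit_grid s t i j * G s t) = G i j"
  using sum_box_indicator[of "{i}" n "{j}" G] assms
  by (simp add: unit_grid_def eq_commute[of i] eq_commute[of j] conj_commute)

text \<open>The sum of \<open>G\<close> over the positions that precede \<open>(i, j)\<close> on its diagonal.\<close>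
fun diag_sum :: "grid \<Rightarrow> grid" where
  "diag_sum G (Suc i) (Suc j) = diag_sum G i j + G i j"
| "diag_sum G 0 j = 0"
| "diag_sum G i 0 = 0"

lemma diag_sum_linear:
  "i \<le> n \<Longrightarrow> j \<le> n \<Longrightarrow>
    diag_sum G i j = (\<Sum>s<n. \<Sum>t<n. diag_sum (unit_grid s t) i j * G s t)"
proof (induction G i j rule: diag_sum.induct)
  case (1 G i j)
  have "G i j = (\<Sum>s<n. \<Sum>t<n. unit_grid s t i j * G s t)"
    using sum_unit_grid[of i n j G] 1 by simp
  then show ?case using 1 by (simp add: distrib_right sum.distrib)
qed simp_all

lemma diag_sum_unit:
  "diag_sum (unit_grid s t) i j = (if s < i \<and> t < j \<and> i + t = j + s then 1 else 0)"
  by (induction "unit_grid s t" i j rule: diag_sum.induct) (auto simp: unit_grid_def)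

lemma diag_sum_const_minus:
  "diag_sum (\<lambda>s t. g - G s t) i j = g * int (min i j) - diag_sum G i j"
  by (induction G i j rule: diag_sum.induct) (auto simp: algebra_simps)

text \<open>The obstruction to \<open>2 G\<close> being a value of the form operator. It expresses that the sums of
  \<open>G\<close> over whole diagonals are tied to the corner value \<open>G 0 (n - 1)\<close>: the main diagonal sums
  to \<open>n - 2\<close> times the corner, and the two diagonals of total length \<open>n + 1\<close> that end at
  \<open>(n - 1, j)\<close> and at \<open>(n - 1 - j, n - 1)\<close> sum to \<open>n - 1\<close> times the corner.\<close>
definition defect :: "nat \<Rightarrow> grid \<Rightarrow> grid" where
  "defect n G i j = (if Suc i < n then (int n - 2) * G 0 (n - 1) - diag_sum G n n
     else int n * G 0 (n - 1) + diag_sum G n n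
       - 2 * diag_sum G n (Suc j) - 2 * diag_sum G (n - j) n)"

text \<open>A table \<open>R\<close> of cumulative sums whose \<open>mixed_diff\<close> solves \<open>M X = 2 G\<close> whenever this is solvable.
  Column sums and the total are normalised to zero, that is \<open>R n j = 0\<close>; over the rationals this can
  be achieved because the column sums parametrise the kernel. Then the corner value of \<open>2 G\<close> must be
  the moment, so with \<open>g = G 0 (n - 1)\<close> the equation says that
  \<open>R\<close> increases by \<open>g - G i j\<close> plus the row value \<open>R (i + 1) n\<close> along each diagonal step.
  Following a diagonal to the last column determines the row values as differences of
  the numbers \<open>- D (i + 1) n\<close>, where \<open>D\<close> is the diagonal sum of \<open>g - G\<close>, and adding up the steps
  gives the formula for \<open>i < n\<close>.\<close>
definition potential :: "nat \<Rightarrow> grid \<Rightarrow> grid" where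
  "potential n G i j = (let D = diag_sum (\<lambda>s t. G 0 (n - 1) - G s t) in
     if i < n then D i j - D (Suc i) n + D (Suc (i - j)) n else 0)"

text \<open>Rows above the last one satisfy the equation by the choice of the steps, up to the value of the
  moment. In the last row the normalisation \<open>R n j = 0\<close> takes the place of the step, and its
  failure to agree is the second case of the defect.\<close>
lemma form_op_potential:
  assumes ij: "i < n" "j < n"
  shows "form_op n (mixed_diff (potential n G)) i j = 2 * G i j + defect n G i j"
proof -
  define g where "g = G 0 (n - 1)"
  define D where "D = diag_sum (\<lambda>s t. g - G s t)"
  let ?R = "potential n G"
  have R: "?R i j = (if i < n then D i j - D (Suc i) n + D (Suc (i - j)) n else 0)" for i j
    unfolding potential_def D_def g_def Let_def by simp
  have n: "n = Suc (n - 1)" using ij by simp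
  have D00: "D 0 j = 0" "D i 0 = 0" for i j unfolding D_def by (simp, cases i) simp_all
  have DS: "D (Suc i) (Suc j) = D i j + g - G i j" for i j unfolding D_def by simp
  have D1: "D (Suc 0) n = 0" by (subst n) (simp add: DS D00 g_def)
  have R0: "?R 0 j = 0" "?R i 0 = 0" for i j by (simp_all add: R D00)
  have Rn: "?R n j = 0" for j by (simp add: R)
  have row: "?R (Suc i) n = D (Suc i) n - D (Suc (Suc i)) n" if "Suc i < n" for i
    using that D1 by (simp add: R)
  have "(\<Sum>s<n. ?R (Suc s) n) = (\<Sum>s<n - 1. ?R (Suc s) n)"
    using sum.lessThan_Suc[of "\<lambda>s. ?R (Suc s) n" "n - 1"] Rn ij by simp
  also have "\<dots> = (\<Sum>s<n - 1. D (Suc s) n - D (Suc (Suc s)) n)"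
    by (intro sum.cong refl row) auto
  also have "\<dots> = - (\<Sum>s<n - 1. D (Suc (Suc s)) n - D (Suc s) n)"
    by (simp add: sum_subtractf)
  also have "\<dots> = - D n n" using sum_lessThan_telescope[of "\<lambda>s. D (Suc s) n" "n - 1"] D1 n by simp
  finally have m: "moment n ?R = D n n" by (simp add: moment_def Rn)
  have Dg: "D i j = g * int (min i j) - diag_sum G i j" for i j
    unfolding D_def by (rule diag_sum_const_minus)
  have eq: "form_op n (mixed_diff ?R) i j
      = D n n - 2 * (?R (Suc i) (Suc j) - ?R i j - ?R (Suc i) n)"
    using form_op_mixed_diff[of ?R, OF R0 ij] by (simp add: m Rn)
  show ?thesis
  proof (cases "Suc i < n")
    case True
    have "?R (Suc i) (Suc j) - ?R i j - ?R (Suc i) n = g - G i j"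
      using True ij by (simp add: row) (simp add: R DS)
    then show ?thesis using eq True by (simp add: defect_def Dg g_def algebra_simps)
  next
    case False
    then have i: "Suc i = n" using ij by simp
    have "Suc (i - j) = n - j" using i ij by simp
    then have "?R i j = D i j - D n n + D (n - j) n" using ij i by (simp add: R)
    moreover have "D n (Suc j) = D i j + g - G i j" using DS[of i j] i by simp
    ultimately have "form_op n (mixed_diff ?R) i j
        = D n n + 2 * (D n (Suc j) - g + G i j - D n n + D (n - j) n)"
      using eq i by (simp add: Rn)
    then show ?thesis using False ij by (simp add: defect_def Dg g_def algebra_simps of_nat_diff)
  qed
qed

text \<open>Along a diagonal the form telescopes: \<open>diag_sum\<close> of a value of the operator has a closed form in
  the table \<open>R\<close> and its boundary sums \<open>r\<close> and \<open>c\<close> (fact \<open>D\<close> below). In both cases of the defect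
  the boundary sums cancel.\<close>
lemma defect_form_op:
  assumes ij: "i < n" "j < n"
  shows "defect n (form_op n X) i j = 0"
proof -
  define R where "R i j = (\<Sum>s<i. \<Sum>t<j. X s t)" for i j
  have X: "mixed_diff R = X" using mixed_diff_prefix_sum[of X] unfolding R_def .
  have R0: "R 0 j = 0" "R i 0 = 0" for i j by (simp_all add: R_def)
  define G where "G = form_op n X"
  define m where "m = moment n R"
  define T where "T = R n n"
  define r where "r i = (\<Sum>k<i. R (Suc k) n)" for i
  define c where "c j = (\<Sum>k<j. R n (Suc k))" for j
  have rS: "r (Suc i) = r i + R (Suc i) n" and cS: "c (Suc i) = c i + R n (Suc i)" for i
    by (simp_all add: r_def c_def)
  have r0: "r 0 = 0" "c 0 = 0" by (simp_all add: r_def c_def)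
  have G: "G i j = m - (int i + int j) * T - 2 * (R (Suc i) (Suc j) - R i j - R (Suc i) n
      - R n (Suc j) + T)" if "i < n" "j < n" for i j
    using form_op_mixed_diff[of R, OF R0 that] unfolding G_def m_def T_def X .
  have m: "m = 2 * int n * T - r n - c n" by (simp add: m_def moment_def T_def r_def c_def)
  \<comment> \<open>A diagonal with end \<open>(i, j)\<close> has length \<open>min i j\<close>, and \<open>s + t\<close> sums to
    \<open>min i j * (max i j - 1)\<close> over it.\<close>
  have D: "diag_sum G i j = int (min i j) * m
      - 2 * (R i j - (r i - r (i - j)) - (c j - c (j - i)) + int (min i j) * T)
      - int (min i j) * (int (max i j) - 1) * T" if "i \<le> n" "j \<le> n" for i j
    using that
  proof (induction i arbitrary: j)
    case 0
    then show ?case by (simp add: R0 r0)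
  next
    case (Suc i)
    show ?case
    proof (cases j)
      case 0
      then show ?thesis by (simp add: R0 r0)
    next
      case j: (Suc j')
      have less: "i < n" "j' < n" using Suc.prems j by auto
      have "int (min i j') + int (max i j') = int i + int j'" by (simp add: min_def max_def)
      then have "T * int (min i j') + T * int (max i j') = T * int i + T * int j'"
        by (metis distrib_left)
      then show ?thesis using Suc.IH[of j'] less G[OF less] unfolding j
        by (simp add: rS cS algebra_simps)
    qed
  qed
  have n': "n - 1 < n" "0 < n" using ij by auto
  have g: "G 0 (n - 1) = m - (int n - 1) * T"
    using G[OF n'(2,1)] n' R0 by (simp add: T_def of_nat_diff)
  have Dnn: "diag_sum G n n = int n * m - 2 * (T - r n - c n + int n * T) - int n * (int n - 1) * T"
    using D[of n n] by (simp add: r0 T_def)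
  have D1: "diag_sum G n (Suc j) = int (Suc j) * m
      - 2 * (R n (Suc j) - (r n - r (n - Suc j)) - c (Suc j) + int (Suc j) * T)
      - int (Suc j) * (int n - 1) * T"
    using D[of n "Suc j"] ij by (simp add: r0 min_absorb2 max_absorb1)
  have nj: "int (n - j) = int n - int j" using ij by simp
  have D2: "diag_sum G (n - j) n = (int n - int j) * m
      - 2 * (R (n - j) n - r (n - j) - (c n - c j) + (int n - int j) * T)
      - (int n - int j) * (int n - 1) * T"
    using D[of "n - j" n] ij by (simp add: r0 min_absorb1 max_absorb2 nj)
  have "r (n - j) = r (n - Suc j) + R (n - j) n" using rS[of "n - Suc j"] ij by (simp add: Suc_diff_Suc)
  then show ?thesis
    unfolding defect_def G_def[symmetric] g Dnn D1 D2 by (simp add: m cS algebra_simps)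
qed

lemma defect_linear:
  assumes "i < n" "j < n"
  shows "defect n G i j = (\<Sum>s<n. \<Sum>t<n. defect n (unit_grid s t) i j * G s t)"
proof -
  have D: "diag_sum G a b = (\<Sum>s<n. \<Sum>t<n. diag_sum (unit_grid s t) a b * G s t)"
    if "a \<le> n" "b \<le> n" for a b by (rule diag_sum_linear[OF that])
  have g: "G 0 (n - 1) = (\<Sum>s<n. \<Sum>t<n. unit_grid s t 0 (n - 1) * G s t)"
    using sum_unit_grid[of 0 n "n - 1" G] assms by simp
  have le: "n \<le> n" "Suc j \<le> n" "n - j \<le> n" using assms by auto
  show ?thesis
    unfolding defect_def D[OF le(1,1)] D[OF le(1,2)] D[OF le(3,1)] g
    by (simp add: left_diff_distrib distrib_right sum.distrib sum_subtractf sum_distrib_left mult.assoc)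
qed

text \<open>The trace of the defect is what separates the trace of \<open>M K\<close> from that of twice the identity.\<close>
lemma defect_trace:
  assumes "n \<ge> 2"
  shows "(\<Sum>i<n. \<Sum>j<n. defect n (unit_grid i j) i j) = - 2 * int n"
proof -
  have e: "defect n (unit_grid i j) i j = (if Suc i < n
      then (int n - 2) * (if i = 0 \<and> j = n - 1 then 1 else 0) - (if i = j then 1 else 0)
      else (if j = n - 1 then 1 else 0) - 2)" if "i < n" "j < n" for i j
    unfolding defect_def diag_sum_unit unfolding unit_grid_def using that assms by auto
  define m where "m = n - 2"
  have n: "n = Suc (Suc m)" using assms m_def by simp
  have row: "(\<Sum>j<n. defect n (unit_grid i j) i j) = (if i = 0 then int n - 2 else 0) - 1"
    if "Suc i < n" for i
  proof -
    have "(\<Sum>j<n. defect n (unit_grid i j) i j)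
        = (\<Sum>j<n. (int n - 2) * (if i = 0 \<and> j = n - 1 then 1 else 0) - (if i = j then 1 else 0))"
      using that by (intro sum.cong) (simp_all add: e)
    then show ?thesis using that
      by (cases "i = 0") (simp_all add: sum_subtractf sum_negf sum_distrib_left[symmetric])
  qed
  have last: "(\<Sum>j<n. defect n (unit_grid (Suc m) j) (Suc m) j) = 1 - 2 * int n"
  proof -
    have "(\<Sum>j<n. defect n (unit_grid (Suc m) j) (Suc m) j) = (\<Sum>j<n. (if j = n - 1 then 1 else 0) - 2)"
      by (intro sum.cong refl) (subst e, simp_all add: n)
    then show ?thesis using assms by (simp add: sum_subtractf)
  qed
  have "(\<Sum>i<n. \<Sum>j<n. defect n (unit_grid i j) i j)
      = (\<Sum>i<Suc m. \<Sum>j<n. defect n (unit_grid i j) i j) + (1 - 2 * int n)"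
    using last n by simp
  also have "(\<Sum>i<Suc m. \<Sum>j<n. defect n (unit_grid i j) i j)
      = (\<Sum>i<Suc m. (if i = 0 then int n - 2 else 0) - 1)"
    by (intro sum.cong refl row) (simp add: n)
  also have "\<dots> = int n - 2 - int (Suc m)" by (simp add: sum_subtractf)
  finally show ?thesis using n by simp
qed

section \<open>The half inverse of the defining matrix\<close>

lemma sum_div_mod:
  fixes f :: grid
  shows "(\<Sum>k<n ^ 2. f (k div n) (k mod n)) = (\<Sum>s<n. \<Sum>t<n. f s t)"
proof -
  have "(\<Sum>k<n * n. f (k div n) (k mod n)) = (\<Sum>s<n. \<Sum>k\<in>{s * n..<s * n + n}. f (k div n) (k mod n))"
    by (rule sum.nat_group[symmetric])
  also have "\<dots> = (\<Sum>s<n. \<Sum>t<n. f s t)"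
  proof (rule sum.cong[OF refl])
    fix s
    have "(\<Sum>k\<in>{s * n..<s * n + n}. f (k div n) (k mod n))
        = (\<Sum>t = 0..<n. f ((t + s * n) div n) ((t + s * n) mod n))"
      using sum.shift_bounds_nat_ivl[of "\<lambda>k. f (k div n) (k mod n)" 0 "s * n" n]
      by (simp add: add.commute)
    also have "\<dots> = (\<Sum>t<n. f s t)" by (simp add: atLeast0LessThan)
    finally show "(\<Sum>k\<in>{s * n..<s * n + n}. f (k div n) (k mod n)) = (\<Sum>t<n. f s t)" .
  qed
  finally show ?thesis by (simp add: power2_eq_square)
qed

lemma div_mod_less: "k < n ^ 2 \<Longrightarrow> k div n < n \<and> k mod n < (n::nat)"
  by (cases "n = 0") (auto simp: power2_eq_square less_mult_imp_div_less)

lemma unit_grid_div_mod: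
  "unit_grid (l div n) (l mod n) (k div n) (k mod n) = (if k = l then 1 else 0)"
  unfolding unit_grid_def by (metis div_mult_mod_eq)

lemma defining_matrix_entry:
  "k < n ^ 2 \<Longrightarrow> l < n ^ 2 \<Longrightarrow> defining_matrix n $$ (k, l)
    = grid_exp (k div n) (k mod n) (l div n) (l mod n)"
  unfolding defining_matrix_def by (simp add: h_exp_lex_pair)

lemma defining_matrix_carrier: "defining_matrix n \<in> carrier_mat (n ^ 2) (n ^ 2)"
  unfolding defining_matrix_def by simp

lemma defining_matrix_alternating: "alternating (n ^ 2) (defining_matrix n)"
  unfolding alternating_def
  by (auto simp: defining_matrix_carrier defining_matrix_entry grid_exp_def)

text \<open>The columns of \<open>K\<close> are the solutions of \<open>M X = 2 G\<close> for the unit grids \<open>G\<close>, up to the defect.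
  Hence \<open>M K\<close> is twice the identity plus the defect, and the defect kills the columns of \<open>M\<close>.\<close>
lemma defining_matrix_half_inverse:
  assumes n: "n \<ge> 2"
  obtains K where "K \<in> carrier_mat (n ^ 2) (n ^ 2)"
    "defining_matrix n * K * defining_matrix n = 2 \<cdot>\<^sub>m defining_matrix n"
    "(\<Sum>k<n ^ 2. (defining_matrix n * K) $$ (k, k)) = 2 * int (n ^ 2) - 2 * int n"
proof -
  let ?M = "defining_matrix n" and ?d = "n ^ 2"
  define K where "K = mat ?d ?d (\<lambda>(k, l).
    mixed_diff (potential n (unit_grid (l div n) (l mod n))) (k div n) (k mod n))"
  have K: "K \<in> carrier_mat ?d ?d" unfolding K_def by simp
  note M = defining_matrix_carrier[of n]
  have MK: "(?M * K) $$ (k, l) = (if k = l then 2 else 0)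
      + defect n (unit_grid (l div n) (l mod n)) (k div n) (k mod n)" if kl: "k < ?d" "l < ?d" for k l
  proof -
    let ?X = "mixed_diff (potential n (unit_grid (l div n) (l mod n)))"
    have "(?M * K) $$ (k, l) = (\<Sum>p<?d. grid_exp (k div n) (k mod n) (p div n) (p mod n)
        * ?X (p div n) (p mod n))"
      unfolding mult_entry[OF M K kl]
      using kl by (intro sum.cong) (auto simp: defining_matrix_entry K_def)
    also have "\<dots> = form_op n ?X (k div n) (k mod n)"
      unfolding form_op_def by (rule sum_div_mod)
    also have "\<dots> = 2 * unit_grid (l div n) (l mod n) (k div n) (k mod n)
        + defect n (unit_grid (l div n) (l mod n)) (k div n) (k mod n)"
      using div_mod_less[OF kl(1)] by (intro form_op_potential) auto
    finally show ?thesis by (simp add: unit_grid_div_mod)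
  qed
  have MKM: "(?M * K * ?M) $$ (k, p) = 2 * ?M $$ (k, p)" if kp: "k < ?d" "p < ?d" for k p
  proof -
    define G where "G = form_op n (unit_grid (p div n) (p mod n))"
    have col: "?M $$ (l, p) = G (l div n) (l mod n)" if l: "l < ?d" for l
    proof -
      have "G (l div n) (l mod n) = (\<Sum>q<?d. grid_exp (l div n) (l mod n) (q div n) (q mod n)
          * unit_grid (p div n) (p mod n) (q div n) (q mod n))"
        unfolding G_def form_op_def by (rule sum_div_mod[symmetric])
      also have "\<dots> = (\<Sum>q<?d. if q = p then grid_exp (l div n) (l mod n) (p div n) (p mod n) else 0)"
        by (intro sum.cong) (auto simp: unit_grid_div_mod)
      finally show ?thesis using l kp by (simp add: defining_matrix_entry)
    qed
    have "(?M * K * ?M) $$ (k, p) = (\<Sum>l<?d. (?M * K) $$ (k, l) * ?M $$ (l, p))"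
      by (rule mult_entry) (use M K kp in auto)
    also have "\<dots> = (\<Sum>l<?d. (if l = k then 2 * ?M $$ (k, p) else 0)
        + defect n (unit_grid (l div n) (l mod n)) (k div n) (k mod n) * G (l div n) (l mod n))"
      using kp by (intro sum.cong) (auto simp: MK col distrib_right)
    also have "\<dots> = 2 * ?M $$ (k, p) + (\<Sum>l<?d.
        defect n (unit_grid (l div n) (l mod n)) (k div n) (k mod n) * G (l div n) (l mod n))"
      using kp by (simp add: sum.distrib)
    also have "(\<Sum>l<?d. defect n (unit_grid (l div n) (l mod n)) (k div n) (k mod n)
          * G (l div n) (l mod n))
        = (\<Sum>s<n. \<Sum>t<n. defect n (unit_grid s t) (k div n) (k mod n) * G s t)"
      by (rule sum_div_mod)
    also have "\<dots> = defect n G (k div n) (k mod n)"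
      using div_mod_less[OF kp(1)] by (intro defect_linear[symmetric]) auto
    also have "\<dots> = 0"
      unfolding G_def using div_mod_less[OF kp(1)] by (intro defect_form_op) auto
    finally show ?thesis by simp
  qed
  have "?M * K * ?M = 2 \<cdot>\<^sub>m ?M"
    using M K MKM by (intro eq_matI) auto
  moreover have "(\<Sum>k<?d. (?M * K) $$ (k, k)) = 2 * int ?d - 2 * int n"
  proof -
    have "(\<Sum>k<?d. (?M * K) $$ (k, k))
        = (\<Sum>k<?d. 2 + defect n (unit_grid (k div n) (k mod n)) (k div n) (k mod n))"
      by (intro sum.cong) (auto simp: MK)
    also have "\<dots> = 2 * int ?d + (\<Sum>k<?d. defect n (unit_grid (k div n) (k mod n)) (k div n) (k mod n))"
      by (simp add: sum.distrib)
    also have "(\<Sum>k<?d. defect n (unit_grid (k div n) (k mod n)) (k div n) (k mod n)) = - 2 * int n"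
      using sum_div_mod[of "\<lambda>s t. defect n (unit_grid s t) s t" n] defect_trace[OF n] by simp
    finally show ?thesis by simp
  qed
  ultimately show ?thesis using that K by blast
qed

section \<open>The canonical form\<close>

text \<open>Modulo \<open>2\<close> the matrix \<open>A\<close> is \<open>1 a\<^sup>T - a 1\<^sup>T\<close>, hence \<open>C\<close> is \<open>w b\<^sup>T - b w\<^sup>T\<close>, and the
  \<open>2 \<times> 2\<close> minors of two vectors satisfy the Pluecker relation. For a matrix in normal form
  and the positions \<open>0, 1, 2, 3\<close> the expression is the product of the first two block entries.\<close>
lemma pfaffian_even:
  fixes a :: "nat \<Rightarrow> int"
  assumes A: "A \<in> carrier_mat d d" and W: "W \<in> carrier_mat d d"
    and par: "\<And>k l. k < d \<Longrightarrow> l < d \<Longrightarrow> even (A $$ (k, l) - (a l - a k))"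
    and ijkl: "i < d" "j < d" "k < d" "l < d"
  defines "C \<equiv> W * A * transpose_mat W"
  shows "even (C $$ (i, j) * C $$ (k, l) - C $$ (i, k) * C $$ (j, l) + C $$ (i, l) * C $$ (j, k))"
proof -
  define w where "w i = (\<Sum>k<d. W $$ (i, k))" for i
  define b where "b i = (\<Sum>k<d. W $$ (i, k) * a k)" for i
  have C: "even (C $$ (i, j) - (w i * b j - b i * w j))" if ij: "i < d" "j < d" for i j
  proof -
    have "w i * b j - b i * w j
        = (\<Sum>l<d. \<Sum>k<d. W $$ (i, k) * (a l - a k) * W $$ (j, l))"
      unfolding w_def b_def sum_product
      by (subst (2) sum.swap, subst sum.swap) (simp add: algebra_simps sum_subtractf)
    then have "C $$ (i, j) - (w i * b j - b i * w j)
        = (\<Sum>l<d. \<Sum>k<d. W $$ (i, k) * (A $$ (k, l) - (a l - a k)) * W $$ (j, l))"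
      unfolding C_def congruence_entry[OF W A ij] by (simp add: algebra_simps sum_subtractf sum.distrib)
    then show ?thesis using par by (auto intro!: dvd_sum)
  qed
  define Q where "Q i j = (C $$ (i, j) - (w i * b j - b i * w j)) div 2" for i j
  have CQ: "C $$ (i, j) = w i * b j - b i * w j + 2 * Q i j" if "i < d" "j < d" for i j
    using C[OF that] unfolding Q_def by simp
  have "C $$ (i, j) * C $$ (k, l) - C $$ (i, k) * C $$ (j, l) + C $$ (i, l) * C $$ (j, k)
    = 2 * ((w i * b j - b i * w j) * Q k l + Q i j * (w k * b l - b k * w l) + 2 * Q i j * Q k l
      - (w i * b k - b i * w k) * Q j l - Q i k * (w j * b l - b j * w l) - 2 * Q i k * Q j l
      + (w i * b l - b i * w l) * Q j k + Q i l * (w j * b k - b j * w k) + 2 * Q i l * Q j k)"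
    using ijkl by (simp add: CQ algebra_simps)
  then show ?thesis by simp
qed

lemma even_congruence:
  assumes A: "A \<in> carrier_mat d d" and "sl_congruent d A C"
    and ev: "\<And>i j. i < d \<Longrightarrow> j < d \<Longrightarrow> even (C $$ (i, j))" and kl: "k < d" "l < d"
  shows "even (A $$ (k, l))"
proof -
  obtain W where W: "W \<in> carrier_mat d d" "det W = 1" and C: "C = W * A * transpose_mat W"
    using assms(2) unfolding sl_congruent_def by blast
  obtain V where V: "V \<in> carrier_mat d d" "W * V = 1\<^sub>m d" "V * W = 1\<^sub>m d"
    by (rule SL_inverse[OF W])
  note assoc = assoc_mult_mat[of _ d d _ d _ d]
  have t: "transpose_mat W * transpose_mat V = 1\<^sub>m d" using transpose_mult[OF V(1) W(1)] V(3) by simp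
  have "V * C * transpose_mat V = (V * W) * A * (transpose_mat W * transpose_mat V)"
    unfolding C using V(1) W(1) A by (simp add: assoc)
  also have "\<dots> = A" unfolding V(3) t using A by simp
  finally have "A $$ (k, l) = (V * C * transpose_mat V) $$ (k, l)" by simp
  also have "\<dots> = (\<Sum>j<d. \<Sum>i<d. V $$ (k, i) * C $$ (i, j) * V $$ (l, j))"
    by (rule congruence_entry) (use V(1) W(1) A C kl in auto)
  finally show ?thesis using ev by (auto intro!: dvd_sum)
qed

theorem theorem7p4:
  fixes n N :: nat
  assumes "n \<ge> 1" and "N = (n ^ 2 - n) div 2"
  shows "is_canonical_form (n ^ 2) (defining_matrix n)
    (diag_block_mat (map D_block [1..<N + 1] @ replicate (n ^ 2 - 2 * N) (0\<^sub>m 1 1)))"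
proof -
  let ?M = "defining_matrix n" and ?d = "n ^ 2"
  note M = defining_matrix_carrier[of n]
  have nn: "n ^ 2 = n * (n - 1) + n" using assms(1) by (cases n) (simp_all add: power2_eq_square)
  have "even (n * (n - 1))" by auto
  then have N: "2 * N = n * (n - 1)" using assms(2) nn by simp
  define ds where "ds i = (if N \<le> i then 0 else if i = 0 then 1 else 2 :: int)" for i
  define xs where "xs = map (\<lambda>j::nat. if j = 1 then - 1 else - 2 :: int) [1..<N + 1]"
  let ?D = "diag_block_mat (map D_block [1..<N + 1] @ replicate (n ^ 2 - 2 * N) (0\<^sub>m 1 1))"
  have D: "?D = diag_block_mat (map skew_block xs @ replicate (n ^ 2 - 2 * N) (0\<^sub>m 1 1))"
    unfolding xs_def map_map comp_def D_block_skew by simp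
  have xs: "(\<lambda>i. if i < length xs then - (xs ! i) else 0) = ds"
    by (auto simp: xs_def ds_def simp del: upt_Suc)
  have "length xs = N" by (simp add: xs_def)
  then have "2 * length xs + (n ^ 2 - 2 * N) = ?d" using N nn by linarith
  then have Dmat: "?D = mat ?d ?d (\<lambda>(i, j). skew_entry ds i j)"
    unfolding D diag_block_mat_skew xs by simp
  have "sl_congruent ?d ?M ?D"
  proof (cases "n = 1")
    case True
    then have "?D = ?M"
      unfolding Dmat by (intro eq_matI)
        (auto simp: defining_matrix_def h_exp_lex_pair grid_exp_def skew_entry_def)
    then show ?thesis using sl_congruent_refl[OF M] by simp
  next
    case False
    then have n: "n \<ge> 2" using assms(1) by simp
    obtain C ms where cong: "sl_congruent ?d ?M C" and C: "C \<in> carrier_mat ?d ?d"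
      and nf': "\<forall>i<?d. \<forall>j<?d. C $$ (i, j) = skew_entry ms i j"
      and chain: "\<forall>i. ms i dvd ms (Suc i)" and out': "\<forall>i. ?d \<le> 2 * i + 1 \<longrightarrow> ms i = 0"
      and pos: "\<forall>i. 2 * i + 2 < ?d \<longrightarrow> ms i \<ge> 0"
      using skew_normal_form[OF defining_matrix_alternating[of n]] by (elim exE conjE)
    note nf = nf'[rule_format] and out = out'[rule_format]
    have dvd: "ms i dvd ms j" if "i \<le> j" for i j
      using that by (induction rule: dec_induct) (auto intro: dvd_trans chain[rule_format])
    obtain K where K: "K \<in> carrier_mat ?d ?d" "?M * K * ?M = 2 \<cdot>\<^sub>m ?M"
      "(\<Sum>k<?d. (?M * K) $$ (k, k)) = 2 * int ?d - 2 * int n"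
      by (rule defining_matrix_half_inverse[OF n])
    obtain L where L: "L \<in> carrier_mat ?d ?d" "C * L * C = 2 \<cdot>\<^sub>m C"
      "(\<Sum>k<?d. (C * L) $$ (k, k)) = (\<Sum>k<?d. (?M * K) $$ (k, k))"
      by (rule half_inverse_congruence[OF M K(1,2) cong])
    note inv = half_inverse_normal_form[OF C L(1,2) nf out]
    define r where "r = (LEAST i. ms i = 0)"
    have "ms ?d = 0" by (rule out) simp
    then have "ms r = 0" unfolding r_def by (rule LeastI)
    then have zero: "ms i = 0 \<longleftrightarrow> r \<le> i" for i
      using dvd[of r i] not_less_Least[of i "\<lambda>i. ms i = 0"] by (auto simp: r_def not_le[symmetric])
    have rd: "2 * r \<le> ?d"
    proof (rule ccontr)
      assume "\<not> 2 * r \<le> ?d"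
      then have "ms (r - 1) = 0" "r \<noteq> 0" by (auto intro!: out)
      then show False using zero[of "r - 1"] by simp
    qed
    \<comment> \<open>There are \<open>r\<close> nonzero blocks; the trace now gives \<open>4 r = 2 n\<^sup>2 - 2 n\<close>.\<close>
    have "(\<Sum>k<?d. (C * L) $$ (k, k)) = (\<Sum>k<?d. if k < 2 * r then 2 else 0)"
      by (intro sum.cong) (auto simp: inv(2) zero)
    also have "\<dots> = (\<Sum>k\<in>{..<?d} \<inter> {..<2 * r}. 2)"
      using sum.inter_restrict[of "{..<?d}" "\<lambda>_. 2 :: int" "{..<2 * r}"] by simp
    also have "{..<?d} \<inter> {..<2 * r} = {..<2 * r}" using rd by auto
    finally have "4 * int r = 2 * int ?d - 2 * int n" using L(3) K(3) by simp
    then have "4 * r = 2 * (n * (n - 1))" using nn by linarith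
    then have r: "r = N" using N by simp
    \<comment> \<open>Nonzero blocks end before the last index, so their signs are under control.\<close>
    have small: "2 * i + 2 < ?d" if "i < N" for i using that N nn n by linarith
    have odd0: "odd (ms 0)"
    proof
      assume "even (ms 0)"
      then have "even (ms i)" for i using dvd[of 0 i] by (meson dvd_trans le0)
      then have "even (C $$ (i, j))" if "i < ?d" "j < ?d" for i j
        using nf[OF that] unfolding skew_entry_def by auto
      moreover have "0 < ?d" "1 < ?d" using n nn by linarith+
      ultimately have "even (?M $$ (0, 1))" using even_congruence[OF M cong] by blast
      moreover have "?M $$ (0, 1) = 1"
        using n \<open>0 < ?d\<close> \<open>1 < ?d\<close> by (subst defining_matrix_entry) (auto simp: grid_exp_def)
      ultimately show False by simp
    qed
    \<comment> \<open>By the chain of divisors, this makes all later entries even as well.\<close>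
    have ev: "even (ms 1)" if "1 < N"
    proof -
      obtain W where W: "W \<in> carrier_mat ?d ?d" and CW: "C = W * ?M * transpose_mat W"
        using cong unfolding sl_congruent_def by blast
      define a where "a k = int (k div n) + int (k mod n)" for k
      have par: "even (?M $$ (k, l) - (a l - a k))" if "k < ?d" "l < ?d" for k l
        using that by (auto simp: defining_matrix_entry grid_exp_def a_def)
      have d4: "0 < ?d" "1 < ?d" "2 < ?d" "3 < ?d" using small[OF that] by linarith+
      then have "even (C $$ (0, 1) * C $$ (2, 3) - C $$ (0, 2) * C $$ (1, 3) + C $$ (0, 3) * C $$ (1, 2))"
        unfolding CW by (intro pfaffian_even[OF M W par]) (assumption | linarith)+
      then have "even (ms 0 * ms 1)" using d4 by (simp add: nf skew_entry_def)
      then show ?thesis using odd0 by simp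
    qed
    have "ms i = ds i" for i
    proof (cases "i < N")
      case False
      then show ?thesis using zero[of i] by (simp add: r ds_def)
    next
      case True
      then have nz: "ms i \<noteq> 0" and "ms i \<ge> 0" using zero[of i] pos[rule_format, OF small[OF True]] r by auto
      moreover have "ms i dvd 2" using inv(1)[of i] nz by blast
      ultimately have "ms i = 1 \<or> ms i = 2"
        using zdvd_imp_le[of "ms i" 2] by linarith
      moreover have "even (ms i)" if "i \<noteq> 0"
        using ev dvd[of 1 i] that True by (auto intro: dvd_trans)
      ultimately show ?thesis using odd0 True by (auto simp: ds_def)
    qed
    then have "ms = ds" by blast
    then have "C = ?D" unfolding Dmat using C nf by (intro eq_matI) auto
    then show ?thesis using cong by simp
  qed
  moreover have "transpose_mat ?M = - ?M"
  proof (intro eq_matI)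
    fix i j assume "i < dim_row (- ?M)" "j < dim_col (- ?M)"
    then have ij: "i < ?d" "j < ?d" using M by auto
    then show "transpose_mat ?M $$ (i, j) = (- ?M) $$ (i, j)"
      using alternating_swap[OF defining_matrix_alternating ij(2,1)] M by simp
  qed (use M in auto)
  moreover have "canonical_shape ?D" unfolding D by (rule canonical_shape_skew)
  ultimately show ?thesis
    unfolding is_canonical_form_def sl_congruent_def using M by blast
qed

end
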